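(* Let $u$ be a $2\pi$-periodic solution of the inviscid Burgers equation $\partial_t u+\frac12\partial_x(u^2)=0$ on $\mathbb T=[0,2\pi)$ and suppose that for some $T_c>0$ and some $\alpha\in(0,1)$ it is smooth on $[0,T_c]$: $u\in L^\infty([0,T_c],C^{1+\alpha}(\mathbb T))$. Let $u_N(x,t)=\sum_{|k|\le N}\widehat u_k(t)e^{ikx}$ be the spectral Fourier approximation, i.e. the solution of $$\partial_t u_N(x,t)+\tfrac12\,\partial_x\big(P_N[u_N^2]\big)(x,t)=0,\qquad u_N(\cdot,0)=P_N u(\cdot,0).$$ Then $\|u_N(\cdot,t)-u(\cdot,t)\|_{L^2}\to 0$ as $N\to\infty$ for $0\le t\le T_c$. Moreover, for every $s>\frac32$ the following spectral convergence rate estimate holds with a constant independent of $N$: $$\|u_N(\cdot,t)-u(\cdot,t)\|^2_{L^2}\lesssim e^{\int_0^t\|u_x(\cdot,\tau)\|_{L^\infty}d\tau}\Big(N^{-2s}\|u(\cdot,0)\|^2_{H^s}+N^{\frac32-s}\max_{\tau\le t}\|u(\cdot,\tau)\|_{H^s}\Big).$$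
   Context: $P_N$ denotes the spectral Fourier projection on $\mathbb T$: $P_N[w](x)=\sum_{|k|\le N}\widehat w(k)e^{ikx}$ with $\widehat w(k)=\frac1{2\pi}\int_0^{2\pi}w(x)e^{-ikx}dx$. $H^s$ denotes the periodic Sobolev space of order $s$. The notation $A\lesssim B$ means $A\le CB$ with $C$ independent of $N$. *)

theory Defs
  imports "HOL-Analysis.Analysis"
begin

definition fcoef :: "(real \<Rightarrow> complex) \<Rightarrow> int \<Rightarrow> complex" where
  "fcoef w k = integral {0..2*pi} (\<lambda>x. w x * cis (- (of_int k * x))) / complex_of_real (2*pi)"

definition PN :: "nat \<Rightarrow> (real \<Rightarrow> complex) \<Rightarrow> real \<Rightarrow> complex" where
  "PN N w x = (\<Sum>k\<in>{- int N..int N}. fcoef w k * cis (of_int k * x))"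

definition L2norm :: "(real \<Rightarrow> complex) \<Rightarrow> real" where
  "L2norm w = sqrt (integral {0..2*pi} (\<lambda>x. (cmod (w x))\<^sup>2))"

definition in_Hs :: "real \<Rightarrow> (real \<Rightarrow> complex) \<Rightarrow> bool" where
  "in_Hs s w \<longleftrightarrow> (\<lambda>k::int. (1 + (of_int k)\<^sup>2) powr s * (cmod (fcoef w k))\<^sup>2) summable_on UNIV"

definition Hs_norm :: "real \<Rightarrow> (real \<Rightarrow> complex) \<Rightarrow> real" where
  "Hs_norm s w = sqrt (\<Sum>\<^sub>\<infinity>k::int. (1 + (of_int k)\<^sup>2) powr s * (cmod (fcoef w k))\<^sup>2)"

definition Linf_norm :: "(real \<Rightarrow> real) \<Rightarrow> real" where
  "Linf_norm w = Sup (range (\<lambda>x. \<bar>w x\<bar>))"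

end

theory Submission
  imports Defs
begin

text \<open>Write \<open>w = u\<^sub>N\<close>, which is real-valued with conserved \<open>L\<^sup>2\<close> norm. For a Fourier multiplier \<open>T\<close> whose
  symbol is supported in \<open>\<bar>k\<bar> \<le> N\<close>, let \<open>F = \<parallel>w - u\<parallel>\<^sup>2 + 2 \<langle>w, u - T u\<rangle> = \<parallel>w\<parallel>\<^sup>2 + \<parallel>u\<parallel>\<^sup>2 - 2 \<langle>w, T u\<rangle>\<close>. As the
  two norms are conserved and \<open>T\<close> maps into the Galerkin space,
  \<open>F' = - \<integral> (w - u)\<^sup>2 u\<^sub>x + \<integral> w\<^sup>2 (u\<^sub>x - T u\<^sub>x) - 2 \<integral> w (u u\<^sub>x - T (u u\<^sub>x))\<close>,
  in which no derivative falls on \<open>w\<close>, and Gronwall's lemma bounds \<open>F\<close>.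

  For the rate take \<open>T = P\<^sub>N\<close>: the last integral vanishes, and the middle one only sees the modes
  \<open>N < \<bar>k\<bar> \<le> 2N\<close> of \<open>u\<^sub>x\<close>, because \<open>w\<^sup>2\<close> has degree at most \<open>2N\<close> and its Fourier coefficients are bounded by the energy.
  For convergence under mere Hoelder regularity take for \<open>T\<close> the convolution with the positive kernel proportional
  to \<open>(1 + cos x)\<^sup>n\<close>, \<open>n \<le> N\<close> fixed, which approximates \<open>u\<close>, \<open>u\<^sub>x\<close> and \<open>u u\<^sub>x\<close> uniformly in space and time.\<close>


section \<open>Trigonometric polynomials, Fourier coefficients and finite Parseval
  identities\<close>

lemma integral_complex_of_real_continuous:
  fixes f :: "real \<Rightarrow> real"
  assumes "continuous_on {a..b} f"
  shows "integral {a..b} (\<lambda>x. complex_of_real (f x)) = complex_of_real (integral {a..b} f)"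
  using has_integral_of_real[OF integrable_integral[OF integrable_continuous_real[OF assms]]]
  by (rule integral_unique)

text \<open>The coefficient sequence is total and cut off only by the sum, so that a full sequence
  such as \<open>fcoef w\<close>, or a multiplier applied to it, can be plugged in directly.\<close>

definition trig :: "nat \<Rightarrow> (int \<Rightarrow> complex) \<Rightarrow> real \<Rightarrow> complex" where
  "trig N c x = (\<Sum>k\<in>{- int N..int N}. c k * cis (of_int k * x))"

lemma PN_eq_trig: "PN N w = trig N (fcoef w)"
  by (simp add: fun_eq_iff PN_def trig_def)

lemma continuous_on_trig [continuous_intros]: "continuous_on S (trig N c)"
  unfolding trig_def by (intro continuous_intros)

lemma trig_diff: "trig N c x - trig N d x = trig N (\<lambda>k. c k - d k) x"
  by (simp add: trig_def sum_subtractf algebra_simps)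

lemma norm_trig_le: "norm (trig N c x) \<le> (\<Sum>k\<in>{- int N..int N}. norm (c k))"
  unfolding trig_def by (rule order_trans[OF norm_sum]) (simp add: norm_mult)

lemma has_vector_derivative_cis:
  "((\<lambda>x. cis (a * x)) has_vector_derivative \<i> * of_real a * cis (a * x)) (at x within S)"
proof -
  have "((\<lambda>z. exp (\<i> * (of_real a * z))) has_field_derivative
      \<i> * of_real a * exp (\<i> * (of_real a * of_real x))) (at (of_real x))"
    by (auto intro!: derivative_eq_intros)
  from has_vector_derivative_real_field[OF this] show ?thesis
    by (simp add: cis_conv_exp)
qed

lemma has_vector_derivative_trig:
  "(trig N c has_vector_derivative trig N (\<lambda>k. \<i> * of_int k * c k) x) (at x within S)"
proof -
  have "((\<lambda>x. c k * cis (of_int k * x)) has_vector_derivative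
      \<i> * of_int k * c k * cis (of_int k * x)) (at x within S)" for k
    using has_vector_derivative_mult_right[OF has_vector_derivative_cis[of "of_int k" x S], of "c k"]
    by (simp add: mult_ac)
  then show ?thesis
    unfolding trig_def[abs_def] by (intro has_vector_derivative_sum) auto
qed

lemma integral_cis:
  "integral {0..2*pi} (\<lambda>x. cis (of_int k * x)) = (if k = 0 then of_real (2*pi) else 0)"
proof (cases "k = 0")
  case False
  have "((\<lambda>x. cis (of_int k * x) / (\<i> * of_int k)) has_vector_derivative cis (of_int k * x))
      (at x within S)" for x S
    using has_vector_derivative_mult_right[OF has_vector_derivative_cis[of "of_int k" x S], of "1 / (\<i> * of_int k)"] False
    by (simp add: field_simps)
  then have "((\<lambda>x. cis (of_int k * x)) has_integral
      cis (of_int k * (2*pi)) / (\<i> * of_int k) - cis (of_int k * 0) / (\<i> * of_int k)) {0..2*pi}"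
    by (intro fundamental_theorem_of_calculus) auto
  moreover have "cis (of_int k * (2*pi)) = 1"
    using cis_multiple_2pi[of "of_int k"] by (simp add: mult_ac)
  ultimately show ?thesis using False by (simp add: integral_unique)
qed (simp add: cis_zero scaleR_conv_of_real)

lemma integrable_mult_cis:
  "continuous_on {0..2*pi} w \<Longrightarrow> (\<lambda>x. w x * cis (- (a * x))) integrable_on {0..2*pi}"
  by (intro integrable_continuous_real continuous_intros)

lemma fcoef_trig: "fcoef (trig N c) k = (if \<bar>k\<bar> \<le> int N then c k else 0)"
proof -
  have "integral {0..2*pi} (\<lambda>x. trig N c x * cis (- (of_int k * x)))
      = integral {0..2*pi} (\<lambda>x. \<Sum>j\<in>{-int N..int N}. c j * cis (of_int (j - k) * x))"
    by (intro integral_cong)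
      (simp add: trig_def sum_distrib_right mult.assoc cis_mult left_diff_distrib)
  also have "\<dots> = (\<Sum>j\<in>{-int N..int N}. integral {0..2*pi} (\<lambda>x. c j * cis (of_int (j - k) * x)))"
    by (intro integral_sum) (auto intro!: integrable_continuous_real continuous_intros)
  also have "\<dots> = (\<Sum>j\<in>{-int N..int N}. if j = k then c j * of_real (2*pi) else 0)"
    by (intro sum.cong refl) (simp add: integral_cis scaleR_conv_of_real del: of_int_diff)
  also have "\<dots> = (if \<bar>k\<bar> \<le> int N then c k * of_real (2*pi) else 0)"
    by (auto simp: sum.delta)
  finally show ?thesis by (simp add: fcoef_def)
qed

text \<open>Parseval's identity with one polynomial factor: only a finite sum is exchanged with the
  integral, so no Fourier series has to converge.\<close>

lemma integral_mult_cnj_trig: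
  assumes "continuous_on {0..2*pi} f"
  shows "integral {0..2*pi} (\<lambda>x. f x * cnj (trig N c x))
    = of_real (2*pi) * (\<Sum>k\<in>{-int N..int N}. fcoef f k * cnj (c k))"
proof -
  have "integral {0..2*pi} (\<lambda>x. f x * cnj (trig N c x))
      = integral {0..2*pi} (\<lambda>x. \<Sum>k\<in>{-int N..int N}. cnj (c k) * (f x * cis (- (of_int k * x))))"
    by (intro integral_cong) (simp add: trig_def sum_distrib_left cis_cnj mult_ac)
  also have "\<dots> = (\<Sum>k\<in>{-int N..int N}. integral {0..2*pi} (\<lambda>x. cnj (c k) * (f x * cis (- (of_int k * x)))))"
    by (intro integral_sum) (auto intro!: integrable_continuous_real continuous_intros assms)
  also have "\<dots> = (\<Sum>k\<in>{-int N..int N}. of_real (2*pi) * (fcoef f k * cnj (c k)))"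
    by (intro sum.cong refl) (simp add: fcoef_def)
  finally show ?thesis by (simp add: sum_distrib_left)
qed

lemma integral_norm_trig:
  "integral {0..2*pi} (\<lambda>x. (norm (trig N c x))\<^sup>2)
    = 2*pi * (\<Sum>k\<in>{-int N..int N}. (norm (c k))\<^sup>2)"
proof -
  have "complex_of_real (integral {0..2*pi} (\<lambda>x. (norm (trig N c x))\<^sup>2))
      = integral {0..2*pi} (\<lambda>x. of_real ((norm (trig N c x))\<^sup>2))"
    by (rule integral_complex_of_real_continuous[symmetric]) (intro continuous_intros)
  also have "\<dots> = integral {0..2*pi} (\<lambda>x. trig N c x * cnj (trig N c x))"
    by (simp add: complex_norm_square del: of_real_power)
  also have "\<dots> = of_real (2*pi) * (\<Sum>k\<in>{-int N..int N}. fcoef (trig N c) k * cnj (c k))"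
    by (intro integral_mult_cnj_trig continuous_intros)
  also have "\<dots> = of_real (2*pi) * (\<Sum>k\<in>{-int N..int N}. of_real ((norm (c k))\<^sup>2))"
    by (intro arg_cong2[where f="(*)"] refl sum.cong)
      (auto simp: fcoef_trig complex_norm_square simp del: of_real_power)
  also have "\<dots> = of_real (2*pi * (\<Sum>k\<in>{-int N..int N}. (norm (c k))\<^sup>2))" by simp
  finally show ?thesis by (rule of_real_eq_iff[THEN iffD1])
qed

lemma fcoef_diff:
  assumes "continuous_on {0..2*pi} f" "continuous_on {0..2*pi} g"
  shows "fcoef (\<lambda>x. f x - g x) k = fcoef f k - fcoef g k"
  unfolding fcoef_def left_diff_distrib
  by (subst integral_diff) (auto intro!: integrable_mult_cis assms simp: diff_divide_distrib)

lemma fcoef_cnj: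
  "fcoef (\<lambda>x. cnj (f x)) k = cnj (fcoef f (- k))"
  by (simp add: fcoef_def integral_cnj cis_cnj)

lemma norm_fcoef_le_integral:
  assumes "continuous_on {0..2*pi} f"
  shows "norm (fcoef f k) \<le> integral {0..2*pi} (\<lambda>x. norm (f x)) / (2*pi)"
proof -
  have "norm (integral {0..2*pi} (\<lambda>x. f x * cis (- (of_int k * x))))
      \<le> integral {0..2*pi} (\<lambda>x. norm (f x))"
    by (intro integral_norm_bound_integral)
      (auto intro!: integrable_continuous_real continuous_intros assms simp: norm_mult)
  then show ?thesis by (simp add: fcoef_def norm_divide norm_mult divide_right_mono)
qed

lemma norm_fcoef_le:
  assumes "continuous_on {0..2*pi} f" "\<And>x. norm (f x) \<le> B"
  shows "norm (fcoef f k) \<le> B"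
proof -
  have "integral {0..2*pi} (\<lambda>x. norm (f x)) \<le> integral {0..2*pi} (\<lambda>x. B)"
    by (intro integral_le) (auto intro!: integrable_continuous_real continuous_intros assms)
  then have "integral {0..2*pi} (\<lambda>x. norm (f x)) / (2*pi) \<le> B" by (simp add: field_simps)
  with norm_fcoef_le_integral[OF assms(1)] show ?thesis by (meson order_trans)
qed

section \<open>The positive cosine kernel and uniform approximation of periodic functions\<close>

text \<open>With \<open>z = cis h\<close> one has \<open>1 + cos h = (1 + z)^2 / (2 z)\<close>, so
  the power is a binomial expansion of exponent \<open>2 * n\<close> with its index shifted by
  \<open>n\<close>.\<close>

lemma one_plus_cos_power:
  "complex_of_real ((1 + cos h) ^ n)
    = trig n (\<lambda>k. of_real (real ((2 * n) choose nat (int n + k)) / 2 ^ n)) h"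
proof -
  have "complex_of_real (1 + cos h) = cis (- h) * (1 + cis h)\<^sup>2 / 2"
  proof (rule complex_eqI)
    show "Re (complex_of_real (1 + cos h)) = Re (cis (- h) * (1 + cis h)\<^sup>2 / 2)"
      using sin_cos_squared_add[of h] by (simp add: power2_eq_square) algebra
  qed (simp add: power2_eq_square algebra_simps)
  then have "complex_of_real ((1 + cos h) ^ n) = cis (- (real n * h)) * (cis h + 1) ^ (2 * n) / 2 ^ n"
    unfolding of_real_power
    by (simp only: power_mult_distrib power_divide Complex.DeMoivre power_mult add.commute[of 1] mult_minus_right)
  also have "\<dots> = (\<Sum>j\<le>2 * n. of_real (real ((2 * n) choose j) / 2 ^ n) * cis (of_int (int j - int n) * h))"
    unfolding binomial_ring sum_distrib_left sum_divide_distrib Complex.DeMoivre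
  proof (intro sum.cong refl)
    fix j
    have "cis (of_int (int j - int n) * h) = cis (- (real n * h)) * cis (real j * h)"
      by (simp add: cis_mult left_diff_distrib)
    then show "cis (- (real n * h)) * (of_nat (2 * n choose j) * cis (real j * h) * 1 ^ (2 * n - j)) / 2 ^ n
      = of_real (real ((2 * n) choose j) / 2 ^ n) * cis (of_int (int j - int n) * h)"
      by simp
  qed
  also have "\<dots> = trig n (\<lambda>k. of_real (real ((2 * n) choose nat (int n + k)) / 2 ^ n)) h"
    unfolding trig_def
    by (rule sum.reindex_bij_witness[where i="\<lambda>k. nat (int n + k)" and j="\<lambda>j. int j - int n"]) auto
  finally show ?thesis .
qed

text \<open>Only the zero mode survives integration over a period, which leaves the central binomial
  coefficient.\<close>

lemma integral_one_plus_cos_power: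
  "integral {0..2*pi} (\<lambda>y. (1 + cos (x - y)) ^ n) = 2 * pi * real ((2 * n) choose n) / 2 ^ n"
proof -
  let ?q = "\<lambda>k. complex_of_real (real ((2 * n) choose nat (int n + k)) / 2 ^ n)"
  have "complex_of_real (integral {0..2*pi} (\<lambda>y. (1 + cos (x - y)) ^ n))
      = integral {0..2*pi} (\<lambda>y. complex_of_real ((1 + cos (x - y)) ^ n))"
    by (rule integral_complex_of_real_continuous[symmetric]) (intro continuous_intros)
  also have "\<dots> = integral {0..2*pi} (\<lambda>y. trig n (\<lambda>k. ?q (- k) * cis (- (of_int k * x))) y)"
  proof (rule integral_cong)
    fix y
    have "(1 + cos (x - y)) ^ n = (1 + cos (y - x)) ^ n"
      by (metis cos_minus minus_diff_eq)
    then show "complex_of_real ((1 + cos (x - y)) ^ n) = trig n (\<lambda>k. ?q (- k) * cis (- (of_int k * x))) y"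
      unfolding one_plus_cos_power trig_def
      by (intro sum.reindex_bij_witness[where i="uminus" and j="uminus"])
        (auto simp: mult.assoc cis_mult algebra_simps)
  qed
  also have "\<dots> = 2 * pi * fcoef (trig n (\<lambda>k. ?q (- k) * cis (- (of_int k * x)))) 0"
    by (simp add: fcoef_def)
  also have "\<dots> = of_real (2 * pi * real ((2 * n) choose n) / 2 ^ n)"
    by (simp add: fcoef_trig)
  finally show ?thesis using of_real_eq_iff by blast
qed

text \<open>Fourier symbol of the de la Vallee Poussin kernel, normalised to the value 1 at
  \<open>k = 0\<close>.\<close>

definition cos_mult :: "nat \<Rightarrow> int \<Rightarrow> real" where
  "cos_mult n k = (if \<bar>k\<bar> \<le> int n then real ((2 * n) choose nat (int n + k)) / real ((2 * n) choose n) else 0)"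

text \<open>The de la Vallee Poussin kernel: as \<open>1 + cos h\<close> is twice the square of
  \<open>cos (h / 2)\<close>, it is proportional to an even power of \<open>cos (h / 2)\<close>. The
  constant gives it mass one over a period.\<close>

definition cos_kernel :: "nat \<Rightarrow> real \<Rightarrow> real" where
  "cos_kernel n h = (1 + cos h) ^ n * 2 ^ n / (2 * pi * real ((2 * n) choose n))"

lemma cos_kernel_nonneg: "0 \<le> cos_kernel n h"
proof -
  have "0 \<le> 1 + cos h" using cos_ge_minus_one[of h] by linarith
  then show ?thesis unfolding cos_kernel_def by simp
qed

lemma continuous_on_cos_kernel [continuous_intros]:
  fixes f :: "real \<Rightarrow> real"
  shows "continuous_on S f \<Longrightarrow> continuous_on S (\<lambda>x. cos_kernel n (f x))"
  unfolding cos_kernel_def by (intro continuous_intros) auto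

lemma cos_kernel_expand:
  "complex_of_real (cos_kernel n h) = trig n (\<lambda>k. of_real (cos_mult n k)) h / of_real (2*pi)"
  unfolding cos_kernel_def of_real_divide of_real_mult one_plus_cos_power trig_def sum_distrib_right sum_divide_distrib
  by (intro sum.cong refl) (auto simp: cos_mult_def field_simps)

text \<open>The multiplier is convolution with the kernel; \<open>n \<le> N\<close> ensures that
  summing up to \<open>N\<close> cuts off no mode of the kernel.\<close>

lemma trig_cos_mult_eq_integral:
  assumes "continuous_on {0..2*pi} f" "n \<le> N"
  shows "trig N (\<lambda>k. of_real (cos_mult n k) * fcoef f k) x
    = integral {0..2*pi} (\<lambda>y. of_real (cos_kernel n (x - y)) * f y)"
proof -
  have "integral {0..2*pi} (\<lambda>y. of_real (cos_kernel n (x - y)) * f y)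
      = integral {0..2*pi} (\<lambda>y. \<Sum>k\<in>{-int n..int n}. of_real (cos_mult n k) * cis (of_int k * x) / of_real (2*pi)
          * (f y * cis (- (of_int k * y))))"
  proof (rule integral_cong)
    fix y
    have "cis (of_int k * (x - y)) = cis (of_int k * x) * cis (- (of_int k * y))" for k :: int
      by (simp add: cis_mult right_diff_distrib)
    then show "of_real (cos_kernel n (x - y)) * f y
      = (\<Sum>k\<in>{-int n..int n}. of_real (cos_mult n k) * cis (of_int k * x) / of_real (2*pi)
          * (f y * cis (- (of_int k * y))))"
      unfolding cos_kernel_expand trig_def sum_divide_distrib sum_distrib_right
      by (intro sum.cong refl) (simp add: mult_ac)
  qed
  also have "\<dots> = (\<Sum>k\<in>{-int n..int n}. integral {0..2*pi} (\<lambda>y. of_real (cos_mult n k) * cis (of_int k * x) / of_real (2*pi)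
          * (f y * cis (- (of_int k * y)))))"
    by (intro integral_sum) (auto intro!: integrable_continuous_real continuous_intros assms)
  also have "\<dots> = (\<Sum>k\<in>{-int n..int n}. of_real (cos_mult n k) * fcoef f k * cis (of_int k * x))"
    by (intro sum.cong refl) (simp add: fcoef_def)
  also have "\<dots> = trig N (\<lambda>k. of_real (cos_mult n k) * fcoef f k) x"
    unfolding trig_def using assms(2)
    by (intro sum.mono_neutral_left) (auto simp: cos_mult_def)
  finally show ?thesis by simp
qed

lemma integral_cos_kernel: "integral {0..2*pi} (\<lambda>y. cos_kernel n (x - y)) = 1"
  by (simp add: cos_kernel_def integral_one_plus_cos_power)

lemma central_binomial_Suc:
  "(n + 1) * ((2 * n + 2) choose (n + 1)) = 2 * (2 * n + 1) * ((2 * n) choose n)"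
proof -
  have "(n + 1) * ((2 * n + 2) choose (n + 1)) = (2 * n + 2) * ((2 * n + 1) choose n)"
    using Suc_times_binomial_eq[of "2 * n + 1" n] by (simp add: mult.commute)
  also have "(2 * n + 1) choose n = (2 * n + 1) choose (n + 1)"
    using binomial_symmetric[of n "2 * n + 1"] by simp
  also have "(2 * n + 2) * ((2 * n + 1) choose (n + 1)) = 2 * ((n + 1) * ((2 * n + 1) choose (n + 1)))"
    by simp
  also have "(n + 1) * ((2 * n + 1) choose (n + 1)) = (2 * n + 1) * ((2 * n) choose n)"
    using Suc_times_binomial_eq[of "2 * n" n] by (simp add: mult.commute)
  finally show ?thesis by simp
qed

text \<open>Writing \<open>1 - cos h\<close> as \<open>2 - (1 + cos h)\<close> reduces the moment to
  two total masses, whose ratio comes from \<open>central_binomial_Suc\<close>. As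
  \<open>1 - cos h\<close> behaves like \<open>h^2 / 2\<close> near 0, the moment measures how the
  kernel concentrates.\<close>

lemma integral_cos_kernel_one_minus_cos:
  "integral {0..2*pi} (\<lambda>y. cos_kernel n (x - y) * (1 - cos (x - y))) = 1 / (real n + 1)"
proof -
  let ?c = "2 ^ n / (2 * pi * real ((2 * n) choose n))"
  have "integral {0..2*pi} (\<lambda>y. cos_kernel n (x - y) * (1 - cos (x - y)))
      = integral {0..2*pi} (\<lambda>y. 2 * cos_kernel n (x - y) - ?c * (1 + cos (x - y)) ^ Suc n)"
    by (intro integral_cong) (simp add: cos_kernel_def field_simps)
  also have "\<dots> = 2 - ?c * integral {0..2*pi} (\<lambda>y. (1 + cos (x - y)) ^ Suc n)"
    by (subst integral_diff)
      (auto intro!: integrable_continuous_real continuous_intros simp: integral_cos_kernel simp del: power_Suc)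
  also have "\<dots> = 2 - real ((2 * n + 2) choose (n + 1)) / (2 * real ((2 * n) choose n))"
    by (subst integral_one_plus_cos_power) (simp add: field_simps)
  also have "\<dots> = 2 - (2 * real n + 1) / (real n + 1)"
  proof -
    have "(real n + 1) * real ((2 * n + 2) choose (n + 1)) = 2 * (2 * real n + 1) * real ((2 * n) choose n)"
      using arg_cong[OF central_binomial_Suc[of n], of real]
      unfolding of_nat_mult of_nat_add by (simp only: of_nat_1 of_nat_numeral)
    moreover have "real ((2 * n) choose n) \<noteq> 0" by simp
    ultimately show ?thesis by (simp add: field_simps del: binomial_eq_0_iff)
  qed
  also have "\<dots> = 1 / (real n + 1)" by (simp add: field_simps)
  finally show ?thesis .
qed

text \<open>Korovkin's argument: a positive kernel of mass one averages \<open>f y - f x\<close>,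
  hence also the assumed bound, and the moment of \<open>1 - cos\<close> supplies the factor
  \<open>1 / (n + 1)\<close>.\<close>

lemma norm_trig_cos_mult_diff_le:
  assumes cont: "continuous_on UNIV f" and n: "n \<le> N"
    and mod: "\<And>y. norm (f y - f x) \<le> e + B * (1 - cos (x - y))"
  shows "norm (trig N (\<lambda>k. of_real (cos_mult n k) * fcoef f k) x - f x) \<le> e + B / (real n + 1)"
proof -
  have cont': "continuous_on S f" for S using cont by (rule continuous_on_subset) simp
  have 1: "integral {0..2*pi} (\<lambda>y. complex_of_real (cos_kernel n (x - y))) = 1"
    by (subst integral_complex_of_real_continuous) (auto intro!: continuous_intros simp: integral_cos_kernel)
  have "trig N (\<lambda>k. of_real (cos_mult n k) * fcoef f k) x - f x
     = integral {0..2*pi} (\<lambda>y. of_real (cos_kernel n (x - y)) * f y)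
       - integral {0..2*pi} (\<lambda>y. of_real (cos_kernel n (x - y)) * f x)"
    by (simp add: trig_cos_mult_eq_integral[OF cont' n] 1)
  also have "\<dots> = integral {0..2*pi} (\<lambda>y. of_real (cos_kernel n (x - y)) * (f y - f x))"
    by (subst integral_diff[symmetric])
      (auto intro!: integrable_continuous_real continuous_intros cont' simp: algebra_simps)
  also have "norm \<dots> \<le> integral {0..2*pi} (\<lambda>y. e * cos_kernel n (x - y) + B * (cos_kernel n (x - y) * (1 - cos (x - y))))"
  proof (rule integral_norm_bound_integral)
    fix y
    have "norm (of_real (cos_kernel n (x - y)) * (f y - f x)) \<le> cos_kernel n (x - y) * (e + B * (1 - cos (x - y)))"
      using mod[of y] cos_kernel_nonneg[of n "x - y"] by (simp add: norm_mult mult_left_mono)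
    then show "norm (of_real (cos_kernel n (x - y)) * (f y - f x)) \<le> e * cos_kernel n (x - y) + B * (cos_kernel n (x - y) * (1 - cos (x - y)))"
      by (simp add: algebra_simps)
  qed (auto intro!: integrable_continuous_real continuous_intros cont')
  also have "\<dots> = e + B / (real n + 1)"
    by (subst integral_add)
      (auto intro!: integrable_continuous_real continuous_intros simp: integral_cos_kernel integral_cos_kernel_one_minus_cos)
  finally show ?thesis .
qed

lemma periodic_shift_int:
  fixes f :: "real \<Rightarrow> 'a"
  assumes "\<And>x. f (x + 2*pi) = f x"
  shows "f (x + 2*pi * of_int k) = f x"
proof -
  have nat: "f (x + 2*pi * real n) = f x" for x n
  proof (induction n)
    case (Suc n)
    have "f (x + 2*pi * real (Suc n)) = f (x + 2*pi * real n + 2*pi)" by (simp add: algebra_simps)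
    with Suc assms show ?case by simp
  qed simp
  show ?thesis
  proof (cases "k \<ge> 0")
    case True
    then show ?thesis using nat[of x "nat k"] by simp
  next
    case False
    then show ?thesis using nat[of "x + 2*pi * of_int k" "nat (- k)"] by simp
  qed
qed

text \<open>If \<open>x - y\<close> lies within \<open>d\<close> of a multiple of the period,
  periodicity reduces to the modulus of continuity. Otherwise
  \<open>cos (x - y) \<le> cos d\<close>, and the second term alone is at least the trivial bound
  \<open>2 * M\<close>.\<close>

lemma modulus_one_minus_cos:
  fixes f :: "real \<Rightarrow> complex"
  assumes per: "\<And>x. f (x + 2*pi) = f x" and bd: "\<And>x. norm (f x) \<le> M"
    and mod: "\<And>x y. \<bar>x - y\<bar> < d \<Longrightarrow> norm (f x - f y) \<le> e"
    and d: "0 < d" "d \<le> pi" and e: "0 \<le> e"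
  shows "norm (f y - f x) \<le> e + 2 * M / (1 - cos d) * (1 - cos (x - y))"
proof -
  \<comment> \<open>Subtracting the nearest multiple of the period brings the difference into
    \<open>[-pi, pi]\<close>, where cosine decreases in the absolute value.\<close>
  define k where "k = round ((x - y) / (2*pi))"
  define h where "h = x - y - 2*pi * of_int k"
  have cd: "cos d < 1" using cos_monotone_0_pi[of 0 d] d by simp
  have M: "0 \<le> M" using bd[of 0] norm_ge_zero order_trans by blast
  have "\<bar>(x - y) / (2*pi) - of_int k\<bar> \<le> 1/2"
    unfolding k_def using of_int_round_abs_le[of "(x - y) / (2*pi)"] by (simp add: abs_minus_commute)
  moreover have "(x - y) / (2*pi) - of_int k = h / (2*pi)" by (simp add: h_def field_simps)
  ultimately have h: "\<bar>h\<bar> \<le> pi" by (simp add: abs_divide field_simps)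
  have cosh: "cos (x - y) = cos \<bar>h\<bar>"
  proof -
    have "cos (x - y) = cos (h + 2*pi * of_int k)" by (simp add: h_def)
    also have "\<dots> = cos h" by (rule periodic_shift_int) simp
    finally show ?thesis by simp
  qed
  show ?thesis
  proof (cases "\<bar>h\<bar> < d")
    case True
    have "f (y + h) = f x"
      using periodic_shift_int[of f "y + h" k, OF per] by (simp add: h_def algebra_simps)
    moreover have "norm (f y - f (y + h)) \<le> e" using True by (intro mod) simp
    moreover have "0 \<le> 2 * M / (1 - cos d) * (1 - cos (x - y))"
      using M cd by (intro mult_nonneg_nonneg divide_nonneg_nonneg) auto
    ultimately show ?thesis by simp
  next
    case False
    then have "cos \<bar>h\<bar> \<le> cos d" using h d by (intro cos_monotone_0_pi_le) auto
    then have "2 * M \<le> 2 * M / (1 - cos d) * (1 - cos (x - y))"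
      using M cd by (simp add: cosh field_simps mult_left_mono)
    moreover have "norm (f y - f x) \<le> 2 * M" using norm_triangle_ineq4[of "f y" "f x"] bd[of x] bd[of y] by linarith
    ultimately show ?thesis using e by linarith
  qed
qed

text \<open>The degree \<open>n\<close> depends on \<open>f\<close> only through \<open>M\<close>,
  \<open>d\<close> and \<open>e\<close>, so one \<open>n\<close> serves all times and each of
  \<open>u\<close>, \<open>ux\<close> and their product.\<close>

lemma uniform_trig_approx:
  assumes "0 < d" "0 < e"
  obtains n where "\<And>N f x. n \<le> N \<Longrightarrow> continuous_on UNIV f \<Longrightarrow> (\<And>x. f (x + 2*pi) = f x) \<Longrightarrow>
      (\<And>x. norm (f x) \<le> M) \<Longrightarrow> (\<And>x y. \<bar>x - y\<bar> < d \<Longrightarrow> norm (f x - f y) \<le> e) \<Longrightarrow>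
      norm (trig N (\<lambda>k. of_real (cos_mult n k) * fcoef f k) x - f x) \<le> 2 * e"
proof -
  \<comment> \<open>Cosine is monotone on \<open>[0, pi]\<close>, so \<open>d\<close> is capped
    there.\<close>
  define d' where "d' = min d pi"
  have d': "0 < d'" "d' \<le> pi" "d' \<le> d" using assms by (auto simp: d'_def)
  define B where "B = 2 * M / (1 - cos d')"
  \<comment> \<open>This choice makes the moment term at most \<open>e\<close>; the modulus of
    continuity contributes the other \<open>e\<close>.\<close>
  obtain n :: nat where "B / e < real n" using reals_Archimedean2 by blast
  then have n: "B / (real n + 1) \<le> e" using assms by (simp add: field_simps)
  show thesis
  proof (rule that[of n])
    fix N x and f :: "real \<Rightarrow> complex"
    assume *: "n \<le> N" "continuous_on UNIV f" "\<And>x. f (x + 2*pi) = f x" "\<And>x. norm (f x) \<le> M"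
      "\<And>x y. \<bar>x - y\<bar> < d \<Longrightarrow> norm (f x - f y) \<le> e"
    have "norm (f y - f x) \<le> e + B * (1 - cos (x - y))" for y
      unfolding B_def by (rule modulus_one_minus_cos[where f=f]) (use * d' assms in auto)
    from norm_trig_cos_mult_diff_le[OF *(2,1) this] n
    show "norm (trig N (\<lambda>k. of_real (cos_mult n k) * fcoef f k) x - f x) \<le> 2 * e" by linarith
  qed
qed

section \<open>Gronwall's inequality\<close>

text \<open>With \<open>A\<close> the primitive of \<open>L\<close>, the function
  \<open>F * exp (- A) - d * t\<close> is nonincreasing. Nonnegativity of \<open>L\<close> gives
  \<open>exp (- A) \<le> 1\<close>, which lets the forcing enter as \<open>d * t\<close>.\<close>

lemma gronwall:
  fixes F F' L :: "real \<Rightarrow> real"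
  assumes deriv: "\<And>t. t \<in> {0..T} \<Longrightarrow> (F has_real_derivative F' t) (at t within {0..T})"
    and L: "continuous_on {0..T} L"
    and L0: "\<And>t. t \<in> {0..T} \<Longrightarrow> 0 \<le> L t"
    and d: "0 \<le> d"
    and le: "\<And>t. t \<in> {0..T} \<Longrightarrow> F' t \<le> L t * F t + d"
    and t: "t \<in> {0..T}"
  shows "F t \<le> exp (integral {0..t} L) * (F 0 + d * t)"
proof -
  define A where "A = (\<lambda>t. integral {0..t} L)"
  define G where "G = (\<lambda>t. F t * exp (- A t) - d * t)"
  have A': "(A has_real_derivative L s) (at s within {0..T})" if "s \<in> {0..T}" for s
    unfolding A_def using integral_has_real_derivative[OF L that] .
  have G': "(G has_real_derivative (F' s - L s * F s) * exp (- A s) - d) (at s within {0..T})"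
    if "s \<in> {0..T}" for s
    unfolding G_def using deriv[OF that] A'[OF that]
    by (auto intro!: derivative_eq_intros simp: algebra_simps)
  have A_nonneg: "0 \<le> A s" if "s \<in> {0..T}" for s
    unfolding A_def using that by (intro integral_nonneg integrable_continuous_real continuous_on_subset[OF L]) (auto intro: L0)
  have "G t \<le> G 0"
  proof (rule DERIV_nonpos_imp_decreasing_open[of 0 t G])
    show "0 \<le> t" using t by simp
    show "continuous_on {0..t} G"
      using t by (intro continuous_on_subset[OF DERIV_continuous_on[OF G']]) auto
    fix s assume s: "0 < s" "s < t"
    then have "s \<in> {0..T}" using t by auto
    have "(F' s - L s * F s) * exp (- A s) \<le> d * exp (- A s)"
      using le[OF \<open>s \<in> {0..T}\<close>] by (intro mult_right_mono) auto
    also have "\<dots> \<le> d * 1"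
      using A_nonneg[OF \<open>s \<in> {0..T}\<close>] d by (intro mult_left_mono) auto
    finally have "(F' s - L s * F s) * exp (- A s) - d \<le> 0" by simp
    moreover have "(G has_real_derivative (F' s - L s * F s) * exp (- A s) - d) (at s)"
      using G'[OF \<open>s \<in> {0..T}\<close>] s t by (simp add: at_within_Icc_at)
    ultimately show "\<exists>y. DERIV G s :> y \<and> y \<le> 0" by blast
  qed
  then have "F t * exp (- A t) \<le> F 0 + d * t" by (simp add: G_def A_def)
  then have "exp (A t) * (F t * exp (- A t)) \<le> exp (A t) * (F 0 + d * t)" by (simp add: mult_left_mono)
  also have "exp (A t) * (F t * exp (- A t)) = F t * (exp (A t) * exp (- A t))" by (simp only: mult_ac)
  finally show ?thesis by (simp add: A_def flip: exp_add)
qed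

section \<open>Recovering Fourier coefficients from finitely many point values\<close>

lemma sum_cis_roots_of_unity:
  assumes "\<bar>m\<bar> < int M" "m \<noteq> 0"
  shows "(\<Sum>j<M. cis (of_int m * (2*pi * real j / real M))) = 0"
proof -
  define z where "z = cis (of_int m * (2*pi) / real M)"
  have M: "M > 0" using assms by auto
  have "z \<noteq> 1"
  proof
    assume "z = 1"
    then have "cos (of_int m * (2*pi) / real M) = 1" by (simp add: z_def complex_eq_iff)
    then obtain l :: int where "of_int m * (2*pi) / real M = of_int l * 2 * pi"
      using cos_one_2pi_int by auto
    then have "of_int m = real_of_int (l * int M)" using M by (simp add: field_simps)
    then have "m = l * int M" by linarith
    with assms show False
      by (metis abs_mult abs_of_nat dvd_imp_le_int dvd_triv_right not_le)
  qed
  have "(\<Sum>j<M. cis (of_int m * (2*pi * real j / real M))) = (\<Sum>j<M. z ^ j)"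
    by (intro sum.cong refl) (simp add: z_def Complex.DeMoivre mult_ac)
  also have "\<dots> = (z ^ M - 1) / (z - 1)" using \<open>z \<noteq> 1\<close> by (rule geometric_sum)
  also have "z ^ M = 1"
    using M cis_multiple_2pi[of "of_int m"] by (simp add: z_def Complex.DeMoivre mult_ac)
  finally show ?thesis by simp
qed

text \<open>Discrete Fourier inversion: two frequencies differ by at most \<open>2 * N\<close>, so
  \<open>2 * N + 1\<close> equally spaced points separate them without aliasing.\<close>

lemma trig_coeff_eq_sample:
  assumes "\<bar>k\<bar> \<le> int N"
  shows "c k = (\<Sum>j<2*N+1. trig N c (2*pi * real j / real (2*N+1))
            * cis (- (of_int k * (2*pi * real j / real (2*N+1))))) / of_nat (2*N+1)"
proof -
  let ?M = "2*N+1" and ?x = "\<lambda>j. 2*pi * real j / real (2*N+1)"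
  have "(\<Sum>j<?M. trig N c (?x j) * cis (- (of_int k * ?x j)))
      = (\<Sum>j<?M. \<Sum>l\<in>{-int N..int N}. c l * cis (of_int (l - k) * ?x j))"
    by (intro sum.cong refl)
      (simp add: trig_def sum_distrib_right mult.assoc cis_mult left_diff_distrib diff_divide_distrib)
  also have "\<dots> = (\<Sum>l\<in>{-int N..int N}. c l * (\<Sum>j<?M. cis (of_int (l - k) * ?x j)))"
    by (subst sum.swap) (simp only: sum_distrib_left)
  also have "\<dots> = (\<Sum>l\<in>{-int N..int N}. if l = k then c l * of_nat ?M else 0)"
  proof (intro sum.cong refl)
    fix l assume l: "l \<in> {-int N..int N}"
    show "c l * (\<Sum>j<?M. cis (of_int (l - k) * ?x j)) = (if l = k then c l * of_nat ?M else 0)"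
    proof (cases "l = k")
      case False
      moreover have "\<bar>l - k\<bar> < int ?M" using l assms by auto
      ultimately show ?thesis using sum_cis_roots_of_unity[of "l - k" ?M] by (simp del: sum.lessThan_Suc)
    qed (simp add: cis_zero)
  qed
  also have "\<dots> = c k * of_nat ?M" using assms by (simp add: sum.delta abs_le_iff)
  finally have *: "(\<Sum>j<?M. trig N c (?x j) * cis (- (of_int k * ?x j))) = c k * of_nat ?M" .
  have "complex_of_nat ?M \<noteq> 0" by (simp only: of_nat_eq_0_iff)
  then show ?thesis unfolding * by (rule nonzero_mult_div_cancel_right[symmetric])
qed

text \<open>The evolution equation is given pointwise in \<open>x\<close>. A coefficient is a fixed
  linear combination of \<open>2 * N + 1\<close> point values and so inherits the time derivative
  without any exchange of limit and integral.\<close>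

lemma has_vector_derivative_trig_coeff:
  assumes "\<And>x. ((\<lambda>\<tau>. trig N (c \<tau>) x) has_vector_derivative trig N d x) (at t within S)"
    and k: "\<bar>k\<bar> \<le> int N"
  shows "((\<lambda>\<tau>. c \<tau> k) has_vector_derivative d k) (at t within S)"
proof -
  have "((\<lambda>\<tau>. (\<Sum>j<2*N+1. trig N (c \<tau>) (2*pi * real j / real (2*N+1))
            * cis (- (of_int k * (2*pi * real j / real (2*N+1))))) / of_nat (2*N+1))
      has_vector_derivative (\<Sum>j<2*N+1. trig N d (2*pi * real j / real (2*N+1))
            * cis (- (of_int k * (2*pi * real j / real (2*N+1))))) / of_nat (2*N+1)) (at t within S)"
    by (intro has_vector_derivative_divide has_vector_derivative_sum has_vector_derivative_mult_left assms)
  then show ?thesis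
    by (simp only: trig_coeff_eq_sample[OF k, symmetric])
qed

section \<open>The Galerkin system: real values and conservation of energy\<close>

lemma cnj_trig: "cnj (trig N c x) = trig N (\<lambda>k. cnj (c (- k))) x"
  unfolding trig_def cnj_sum
  by (rule sum.reindex_bij_witness[where i=uminus and j=uminus]) (auto simp: cis_cnj)

lemma trig_periodic: "trig N c (x + 2*pi) = trig N c x"
proof -
  have "cis (of_int k * (x + 2*pi)) = cis (of_int k * x)" for k :: int
    using cis_multiple_2pi[of "of_int k"] by (simp add: distrib_left mult_ac flip: cis_mult)
  then show ?thesis by (simp add: trig_def)
qed

lemma has_real_derivative_Re_mult_cnj:
  assumes "(f has_vector_derivative f') (at t within S)" "(g has_vector_derivative g') (at t within S)"
  shows "((\<lambda>t. Re (f t * cnj (g t))) has_real_derivative Re (f t * cnj g' + f' * cnj (g t))) (at t within S)"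
  unfolding has_real_derivative_iff_has_vector_derivative
  by (intro bounded_linear.has_vector_derivative[OF bounded_linear_Re]
      has_vector_derivative_mult has_vector_derivative_cnj assms)

lemma sum_norm_squared_le:
  "(\<Sum>k\<in>A. norm (c k))\<^sup>2 \<le> real (card A) * (\<Sum>k\<in>A. (norm (c k))\<^sup>2)"
  using Cauchy_Schwarz_ineq_sum[of "\<lambda>_. 1" "\<lambda>k. norm (c k)" A] by simp

text \<open>\<open>w\<close> is complex because \<open>PN\<close> is; reality is required of the
  initial value and propagated by \<open>w_real\<close>.\<close>

locale galerkin =
  fixes N :: nat and T :: real and w :: "real \<Rightarrow> real \<Rightarrow> complex"
  assumes poly: "\<And>t. t \<in> {0..T} \<Longrightarrow> (\<lambda>x. w x t) = PN N (\<lambda>x. w x t)"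
    and ode: "\<And>x t. t \<in> {0..T} \<Longrightarrow>
        ((\<lambda>\<tau>. w x \<tau>) has_vector_derivative
           (- (1/2) * vector_derivative (\<lambda>y. PN N (\<lambda>z. (w z t)\<^sup>2) y) (at x)))
        (at t within {0..T})"
    and init_real: "\<And>x. Im (w x 0) = 0"
begin

definition a :: "real \<Rightarrow> int \<Rightarrow> complex" where "a t k = fcoef (\<lambda>x. w x t) k"

text \<open>Taken for all \<open>k\<close>: the square has degree up to \<open>2 * N\<close>, and
  its modes beyond \<open>N\<close> enter the consistency error.\<close>

definition b :: "real \<Rightarrow> int \<Rightarrow> complex" where "b t k = fcoef (\<lambda>x. (w x t)\<^sup>2) k"

lemma w_eq: "t \<in> {0..T} \<Longrightarrow> w x t = trig N (a t) x"
  using fun_cong[OF poly, of t x] by (simp add: PN_eq_trig a_def[abs_def])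

lemma continuous_on_w: "t \<in> {0..T} \<Longrightarrow> continuous_on S (\<lambda>x. w x t)"
  by (simp add: w_eq continuous_on_trig)

lemma a_deriv:
  assumes t: "t \<in> {0..T}" and k: "\<bar>k\<bar> \<le> int N"
  shows "((\<lambda>\<tau>. a \<tau> k) has_vector_derivative - (\<i> * of_int k / 2) * b t k) (at t within {0..T})"
proof (rule has_vector_derivative_trig_coeff[OF _ k])
  fix x
  have "vector_derivative (\<lambda>y. PN N (\<lambda>z. (w z t)\<^sup>2) y) (at x) = trig N (\<lambda>k. \<i> * of_int k * b t k) x"
    unfolding PN_eq_trig b_def by (rule vector_derivative_at) (rule has_vector_derivative_trig)
  then have "- (1/2) * vector_derivative (\<lambda>y. PN N (\<lambda>z. (w z t)\<^sup>2) y) (at x)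
      = trig N (\<lambda>k. - (\<i> * of_int k / 2) * b t k) x"
    by (simp add: trig_def sum_divide_distrib sum_negf)
  with ode[OF t, of x] have *: "((\<lambda>\<tau>. w x \<tau>) has_vector_derivative
      trig N (\<lambda>k. - (\<i> * of_int k / 2) * b t k) x) (at t within {0..T})" by simp
  show "((\<lambda>\<tau>. trig N (a \<tau>) x) has_vector_derivative
      trig N (\<lambda>k. - (\<i> * of_int k / 2) * b t k) x) (at t within {0..T})"
    by (rule has_vector_derivative_transform[OF t _ *]) (simp add: w_eq)
qed

text \<open>Compactness in time. \<open>A\<close> may depend on \<open>N\<close>, which is harmless
  because it only drives the uniqueness argument in \<open>w_real\<close>.\<close>

lemma a_bounded: obtains A where "0 \<le> A" "\<And>t. t \<in> {0..T} \<Longrightarrow> (\<Sum>k\<in>{-int N..int N}. norm (a t k)) \<le> A"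
proof -
  have "continuous_on {0..T} (\<lambda>t. \<Sum>k\<in>{-int N..int N}. norm (a t k))"
  proof (intro continuous_on_sum continuous_on_norm)
    fix k assume "k \<in> {-int N..int N}"
    then show "continuous_on {0..T} (\<lambda>t. a t k)"
      using a_deriv[of _ k] by (intro continuous_on_vector_derivative[where f'="\<lambda>t. - (\<i> * of_int k / 2) * b t k"]) auto
  qed
  then have "compact ((\<lambda>t. \<Sum>k\<in>{-int N..int N}. norm (a t k)) ` {0..T})"
    by (rule compact_continuous_image) simp
  from compact_imp_bounded[OF this, unfolded bounded_pos] obtain A where A: "0 < A"
      "\<forall>x \<in> (\<lambda>t. \<Sum>k\<in>{-int N..int N}. norm (a t k)) ` {0..T}. norm x \<le> A"
    by (elim exE conjE)
  show thesis
  proof (rule that[of A])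
    fix t assume "t \<in> {0..T}"
    then show "(\<Sum>k\<in>{-int N..int N}. norm (a t k)) \<le> A"
      using bspec[OF A(2) imageI, of t] by simp
  qed (use A in simp)
qed

text \<open>The coefficients \<open>c\<^sub>k\<close> of \<open>w - cnj w\<close> vanish initially and satisfy a homogeneous linear
  system, so the truncated system preserves real-valuedness.\<close>

lemma w_real:
  assumes t: "t \<in> {0..T}"
  shows "Im (w x t) = 0"
proof -
  obtain A where A: "0 \<le> A" "\<And>t. t \<in> {0..T} \<Longrightarrow> (\<Sum>k\<in>{-int N..int N}. norm (a t k)) \<le> A"
    using a_bounded by blast
  define c where "c = (\<lambda>t k. a t k - cnj (a t (- k)))"
  define c' where "c' = (\<lambda>t k. - (\<i> * of_int k / 2) * (b t k - cnj (b t (- k))))"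
  let ?I = "{-int N..int N}"
  let ?S = "\<lambda>t. \<Sum>k\<in>?I. Re (c t k * cnj (c t k))"
  have S_eq: "?S t = (\<Sum>k\<in>?I. (norm (c t k))\<^sup>2)" for t
    by (simp add: complex_norm_square[symmetric] del: of_real_power)
  have w_diff: "w x t - cnj (w x t) = trig N (c t) x" if "t \<in> {0..T}" for x t
    by (simp add: w_eq[OF that] cnj_trig trig_diff c_def)
  have c_deriv: "((\<lambda>\<tau>. c \<tau> k) has_vector_derivative c' t k) (at t within {0..T})"
    if "t \<in> {0..T}" "k \<in> ?I" for t k
    unfolding c_def
  proof (rule has_vector_derivative_eq_rhs)
    show "((\<lambda>\<tau>. a \<tau> k - cnj (a \<tau> (- k))) has_vector_derivative
        - (\<i> * of_int k / 2) * b t k - cnj (- (\<i> * of_int (- k) / 2) * b t (- k))) (at t within {0..T})"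
      using that by (intro has_vector_derivative_diff has_vector_derivative_cnj a_deriv) auto
  qed (simp add: c'_def algebra_simps)
  have c'_le: "norm (c' t k) \<le> real N * A * (\<Sum>k\<in>?I. norm (c t k))" if "t \<in> {0..T}" "k \<in> ?I" for t k
  proof -
    have "b t k - cnj (b t (- k)) = fcoef (\<lambda>x. (w x t)\<^sup>2 - cnj ((w x t)\<^sup>2)) k"
      unfolding b_def fcoef_cnj[symmetric] using that
      by (intro fcoef_diff[symmetric] continuous_intros continuous_on_w) auto
    also have "norm \<dots> \<le> (\<Sum>k\<in>?I. norm (c t k)) * (2 * A)"
    proof (rule norm_fcoef_le)
      fix x
      \<comment> \<open>This factorisation makes the difference of squares linear in
        \<open>c\<close>, the other factor being at most \<open>2 * A\<close>.\<close>
      have "norm ((w x t)\<^sup>2 - cnj ((w x t)\<^sup>2)) = norm (w x t - cnj (w x t)) * norm (w x t + cnj (w x t))"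
        unfolding norm_mult[symmetric] by (simp add: power2_eq_square algebra_simps)
      also have "\<dots> \<le> (\<Sum>k\<in>?I. norm (c t k)) * (2 * A)"
      proof (rule mult_mono)
        show "norm (w x t - cnj (w x t)) \<le> (\<Sum>k\<in>?I. norm (c t k))"
          unfolding w_diff[OF that(1)] by (rule norm_trig_le)
        have "norm (w x t) \<le> A"
          using norm_trig_le[of N "a t" x] A(2)[OF that(1)] w_eq[OF that(1), of x] by simp
        then show "norm (w x t + cnj (w x t)) \<le> 2 * A"
          using norm_triangle_ineq[of "w x t" "cnj (w x t)"] by simp
      qed (auto intro: sum_nonneg)
      finally show "norm ((w x t)\<^sup>2 - cnj ((w x t)\<^sup>2)) \<le> (\<Sum>k\<in>?I. norm (c t k)) * (2 * A)" .
    qed (use that in \<open>intro continuous_intros continuous_on_w; simp\<close>)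
    finally have *: "norm (b t k - cnj (b t (- k))) \<le> (\<Sum>k\<in>?I. norm (c t k)) * (2 * A)" .
    have "norm (c' t k) = \<bar>real_of_int k\<bar> / 2 * norm (b t k - cnj (b t (- k)))"
      by (simp add: c'_def norm_mult norm_divide)
    also have "\<dots> \<le> real N / 2 * ((\<Sum>k\<in>?I. norm (c t k)) * (2 * A))"
    proof (intro mult_mono * divide_right_mono)
      show "\<bar>real_of_int k\<bar> \<le> real N" using that(2) by (auto simp: abs_le_iff)
    qed auto
    finally show ?thesis by (simp add: mult_ac)
  qed
  define K where "K = 2 * real N * A * real (card ?I)"
  \<comment> \<open>Zero forcing and zero initial value make the sum of squares vanish, whatever the
    size of \<open>K\<close>.\<close>
  have "?S t \<le> exp (integral {0..t} (\<lambda>_. K)) * (?S 0 + 0 * t)"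
  proof (rule gronwall[OF _ _ _ _ _ t])
    fix t assume t: "t \<in> {0..T}"
    show "(?S has_real_derivative (\<Sum>k\<in>?I. Re (c t k * cnj (c' t k) + c' t k * cnj (c t k)))) (at t within {0..T})"
      using t by (intro DERIV_sum has_real_derivative_Re_mult_cnj c_deriv)
    have "(\<Sum>k\<in>?I. Re (c t k * cnj (c' t k) + c' t k * cnj (c t k))) \<le> (\<Sum>k\<in>?I. 2 * (real N * A * (\<Sum>k\<in>?I. norm (c t k)) * norm (c t k)))"
    proof (rule sum_mono)
      fix k assume k: "k \<in> ?I"
      have "Re (c t k * cnj (c' t k) + c' t k * cnj (c t k)) \<le> 2 * (norm (c' t k) * norm (c t k))"
        using complex_Re_le_cmod[of "c t k * cnj (c' t k)"] complex_Re_le_cmod[of "c' t k * cnj (c t k)"]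
        by (simp add: norm_mult del: complex_Re_le_cmod)
      also have "\<dots> \<le> 2 * (real N * A * (\<Sum>k\<in>?I. norm (c t k)) * norm (c t k))"
        using c'_le[OF t k] by (intro mult_left_mono mult_right_mono) auto
      finally show "Re (c t k * cnj (c' t k) + c' t k * cnj (c t k)) \<le> 2 * (real N * A * (\<Sum>k\<in>?I. norm (c t k)) * norm (c t k))" .
    qed
    also have "\<dots> = 2 * real N * A * (\<Sum>k\<in>?I. norm (c t k))\<^sup>2"
      by (simp add: power2_eq_square sum_distrib_left[symmetric])
    also have "\<dots> \<le> 2 * real N * A * (real (card ?I) * ?S t)"
      unfolding S_eq using A(1) by (intro mult_left_mono sum_norm_squared_le) auto
    finally show "(\<Sum>k\<in>?I. Re (c t k * cnj (c' t k) + c' t k * cnj (c t k))) \<le> K * ?S t + 0"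
      by (simp only: K_def mult.assoc add_0_right)
  qed (use A(1) in \<open>auto simp: K_def\<close>)
  moreover have "?S 0 = 0"
  proof -
    have "0 \<in> {0..T}" using t by auto
    have "c 0 k = fcoef (\<lambda>x. w x 0 - cnj (w x 0)) k" for k
      unfolding c_def a_def fcoef_cnj[symmetric]
      by (intro fcoef_diff[symmetric] continuous_intros continuous_on_w \<open>0 \<in> {0..T}\<close>)
    moreover have "w x 0 - cnj (w x 0) = 0" for x using init_real[of x] by (simp add: complex_eq_iff)
    ultimately show ?thesis by (simp add: fcoef_def)
  qed
  ultimately have "(\<Sum>k\<in>?I. (norm (c t k))\<^sup>2) \<le> 0" by (simp only: S_eq mult_zero_left mult_zero_right add_0_right)
  then have "(\<Sum>k\<in>?I. (norm (c t k))\<^sup>2) = 0" by (intro antisym sum_nonneg) auto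
  then have "\<forall>k\<in>?I. c t k = 0" by (subst (asm) sum_nonneg_eq_0_iff) auto
  then have "w x t - cnj (w x t) = 0" unfolding w_diff[OF t] by (simp add: trig_def)
  then show ?thesis by (simp add: complex_eq_iff)
qed

text \<open>For real \<open>w\<close> the product of \<open>w^2\<close> and \<open>w_x\<close> is
  the derivative of \<open>w^3 / 3\<close> and integrates to zero over a period. Parseval gives the
  sum, cut off at \<open>N\<close> because \<open>w_x\<close> has degree \<open>N\<close>.\<close>

lemma energy_flux:
  assumes t: "t \<in> {0..T}"
  shows "Re (\<Sum>k\<in>{-int N..int N}. b t k * cnj (\<i> * of_int k * a t k)) = 0"
proof -
  let ?w' = "trig N (\<lambda>k. \<i> * of_int k * a t k)"
  have "((\<lambda>x. (Re (w x t)) ^ 3 / 3) has_vector_derivative Re ((w x t)\<^sup>2 * cnj (?w' x))) (at x within S)" for x S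
  proof -
    have "((\<lambda>x. w x t) has_vector_derivative ?w' x) (at x within S)"
      using has_vector_derivative_trig[of N "a t" x S] by (simp only: w_eq[OF t])
    from bounded_linear.has_vector_derivative[OF bounded_linear_Re this]
    have "((\<lambda>x. Re (w x t)) has_real_derivative Re (?w' x)) (at x within S)"
      by (simp only: has_real_derivative_iff_has_vector_derivative)
    then have "((\<lambda>x. (Re (w x t)) ^ 3 / 3) has_real_derivative (Re (w x t))\<^sup>2 * Re (?w' x)) (at x within S)"
      using DERIV_cdivide[OF DERIV_power[of "\<lambda>x. Re (w x t)" _ x S 3], of _ 3]
      by (simp add: mult.commute[of "(Re (w x t))\<^sup>2"])
    moreover have "Re ((w x t)\<^sup>2 * cnj (?w' x)) = (Re (w x t))\<^sup>2 * Re (?w' x)"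
      by (simp add: power2_eq_square w_real[OF t])
    ultimately show ?thesis by (simp add: has_real_derivative_iff_has_vector_derivative)
  qed
  then have "((\<lambda>x. Re ((w x t)\<^sup>2 * cnj (?w' x))) has_integral
      (Re (w (2*pi) t)) ^ 3 / 3 - (Re (w 0 t)) ^ 3 / 3) {0..2*pi}"
    by (intro fundamental_theorem_of_calculus) auto
  moreover have "w (2*pi) t = w 0 t" using trig_periodic[of N "a t" 0] by (simp add: w_eq[OF t])
  ultimately have 0: "((\<lambda>x. Re ((w x t)\<^sup>2 * cnj (?w' x))) has_integral 0) {0..2*pi}" by simp
  have cont: "continuous_on {0..2*pi} (\<lambda>x. (w x t)\<^sup>2)" by (intro continuous_intros continuous_on_w t)
  have "(\<lambda>x. (w x t)\<^sup>2 * cnj (?w' x)) integrable_on {0..2*pi}"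
    by (intro integrable_continuous_real continuous_intros continuous_on_w t)
  from has_integral_linear[OF integrable_integral[OF this] bounded_linear_Re]
  have "((\<lambda>x. Re ((w x t)\<^sup>2 * cnj (?w' x))) has_integral Re (integral {0..2*pi} (\<lambda>x. (w x t)\<^sup>2 * cnj (?w' x)))) {0..2*pi}"
    by (simp add: o_def)
  from has_integral_unique[OF this 0] show ?thesis
    unfolding integral_mult_cnj_trig[OF cont] b_def[symmetric] by simp
qed

text \<open>Differentiating the squared moduli leaves exactly the flux of
  \<open>energy_flux\<close>.\<close>

lemma energy_conserved:
  assumes t: "t \<in> {0..T}"
  shows "(\<Sum>k\<in>{-int N..int N}. (norm (a t k))\<^sup>2) = (\<Sum>k\<in>{-int N..int N}. (norm (a 0 k))\<^sup>2)"
proof -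
  let ?I = "{-int N..int N}"
  let ?S = "\<lambda>t. \<Sum>k\<in>?I. Re (a t k * cnj (a t k))"
  have S_eq: "?S t = (\<Sum>k\<in>?I. (norm (a t k))\<^sup>2)" for t
    by (simp add: complex_norm_square[symmetric] del: of_real_power)
  have "(?S has_real_derivative 0) (at t within {0..T})" if t: "t \<in> {0..T}" for t
  proof -
    let ?a' = "\<lambda>k. - (\<i> * of_int k / 2) * b t k"
    have "(?S has_real_derivative (\<Sum>k\<in>?I. Re (a t k * cnj (?a' k) + ?a' k * cnj (a t k)))) (at t within {0..T})"
      using t by (intro DERIV_sum has_real_derivative_Re_mult_cnj a_deriv) auto
    moreover have "Re (a t k * cnj (?a' k) + ?a' k * cnj (a t k)) = Re (b t k * cnj (\<i> * of_int k * a t k))" for k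
      by (simp add: algebra_simps add_divide_distrib diff_divide_distrib)
    ultimately show ?thesis using energy_flux[OF t] by simp
  qed
  then obtain e where e: "\<And>t. t \<in> {0..T} \<Longrightarrow> ?S t = e"
    using has_field_derivative_zero_constant[of "{0..T}" ?S, OF convex_real_interval(5)] by meson
  have "?S t = ?S 0" using e[OF t] e[of 0] t by simp
  then show ?thesis by (simp only: S_eq)
qed

end

section \<open>Projection error, Sobolev tails and products of trigonometric polynomials\<close>

lemma Re_integral:
  fixes f :: "real \<Rightarrow> complex"
  assumes "continuous_on {a..b} f"
  shows "Re (integral {a..b} f) = integral {a..b} (\<lambda>x. Re (f x))"
  using integral_linear[OF integrable_continuous_real[OF assms] bounded_linear_Re]
  by (simp add: o_def)

lemma Re_of_real_mult: "Re (of_real r * z) = r * Re z"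
  by simp

lemma integral_norm_trig_diff:
  fixes f :: "real \<Rightarrow> real"
  assumes f: "continuous_on {0..2*pi} f"
  shows "integral {0..2*pi} (\<lambda>x. (norm (trig N c x - of_real (f x)))\<^sup>2)
    = integral {0..2*pi} (\<lambda>x. (f x)\<^sup>2)
      - 4 * pi * (\<Sum>k\<in>{-int N..int N}. Re (fcoef (\<lambda>x. of_real (f x)) k * cnj (c k)))
      + 2 * pi * (\<Sum>k\<in>{-int N..int N}. (norm (c k))\<^sup>2)"
proof -
  have eq: "(norm (trig N c x - of_real (f x)))\<^sup>2
      = (f x)\<^sup>2 - 2 * Re (of_real (f x) * cnj (trig N c x)) + (norm (trig N c x))\<^sup>2" for x
    unfolding cmod_power2 by (simp add: power2_eq_square algebra_simps)
  have "integral {0..2*pi} (\<lambda>x. Re (of_real (f x) * cnj (trig N c x)))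
      = 2 * pi * (\<Sum>k\<in>{-int N..int N}. Re (fcoef (\<lambda>x. of_real (f x)) k * cnj (c k)))"
  proof -
    have "continuous_on {0..2*pi} (\<lambda>x. of_real (f x) * cnj (trig N c x))"
      by (intro continuous_intros f)
    from Re_integral[OF this]
    have "integral {0..2*pi} (\<lambda>x. Re (of_real (f x) * cnj (trig N c x)))
      = Re (integral {0..2*pi} (\<lambda>x. of_real (f x) * cnj (trig N c x)))" by (rule sym)
    also have "\<dots> = Re (of_real (2*pi) * (\<Sum>k\<in>{-int N..int N}. fcoef (\<lambda>x. of_real (f x)) k * cnj (c k)))"
      by (subst integral_mult_cnj_trig) (intro continuous_intros f refl)+
    finally show ?thesis by (simp only: Re_of_real_mult Re_sum)
  qed
  moreover have "integral {0..2*pi} (\<lambda>x. (f x)\<^sup>2 - 2 * Re (of_real (f x) * cnj (trig N c x)) + (norm (trig N c x))\<^sup>2)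
     = integral {0..2*pi} (\<lambda>x. (f x)\<^sup>2) - 2 * integral {0..2*pi} (\<lambda>x. Re (of_real (f x) * cnj (trig N c x)))
       + integral {0..2*pi} (\<lambda>x. (norm (trig N c x))\<^sup>2)"
    by (subst integral_add integral_diff,
        (intro integrable_continuous_real continuous_intros f)+)+ (simp only: integral_mult_right)
  ultimately show ?thesis unfolding eq integral_norm_trig by (simp only: mult.assoc)
qed

text \<open>The left side is the squared distance from \<open>f\<close> to its projection. The
  inequality is completion of the square, mode by mode.\<close>

lemma fourier_best_approx:
  fixes f :: "real \<Rightarrow> real"
  assumes f: "continuous_on {0..2*pi} f"
  shows "integral {0..2*pi} (\<lambda>x. (f x)\<^sup>2)
      - 2 * pi * (\<Sum>k\<in>{-int N..int N}. (norm (fcoef (\<lambda>x. of_real (f x)) k))\<^sup>2)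
    \<le> integral {0..2*pi} (\<lambda>x. (norm (trig N c x - of_real (f x)))\<^sup>2)"
proof -
  let ?f = "fcoef (\<lambda>x. of_real (f x))"
  have "2 * Re (?f k * cnj (c k)) - (norm (c k))\<^sup>2 \<le> (norm (?f k))\<^sup>2" for k
  proof -
    have "0 \<le> (norm (?f k - c k))\<^sup>2" by simp
    then show ?thesis unfolding cmod_power2 by (simp add: power2_eq_square algebra_simps)
  qed
  then have "(\<Sum>k\<in>{-int N..int N}. 2 * Re (?f k * cnj (c k)) - (norm (c k))\<^sup>2)
      \<le> (\<Sum>k\<in>{-int N..int N}. (norm (?f k))\<^sup>2)" by (rule sum_mono)
  then have "2 * pi * (2 * (\<Sum>k\<in>{-int N..int N}. Re (?f k * cnj (c k))) - (\<Sum>k\<in>{-int N..int N}. (norm (c k))\<^sup>2))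
      \<le> 2 * pi * (\<Sum>k\<in>{-int N..int N}. (norm (?f k))\<^sup>2)"
    by (intro mult_left_mono) (simp_all add: sum_subtractf sum_distrib_left)
  then show ?thesis unfolding integral_norm_trig_diff[OF f] by (simp add: algebra_simps)
qed

lemma sobolev_sum_le:
  assumes "in_Hs s f" "finite A"
  shows "(\<Sum>k\<in>A. (1 + (of_int k)\<^sup>2) powr s * (norm (fcoef f k))\<^sup>2) \<le> (Hs_norm s f)\<^sup>2"
proof -
  have "(\<Sum>k\<in>A. (1 + (of_int k)\<^sup>2) powr s * (norm (fcoef f k))\<^sup>2)
      \<le> (\<Sum>\<^sub>\<infinity>k::int. (1 + (of_int k)\<^sup>2) powr s * (norm (fcoef f k))\<^sup>2)"
    using assms unfolding in_Hs_def by (intro finite_sum_le_infsum) auto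
  moreover have "0 \<le> (\<Sum>\<^sub>\<infinity>k::int. (1 + (of_int k)\<^sup>2) powr s * (norm (fcoef f k))\<^sup>2)"
    by (intro infsum_nonneg) auto
  ultimately show ?thesis by (simp add: Hs_norm_def)
qed

lemma Hs_norm_nonneg: "0 \<le> Hs_norm s f"
  unfolding Hs_norm_def by (intro real_sqrt_ge_zero infsum_nonneg) auto

lemma powr_le_sobolev_weight:
  assumes "0 \<le> s" "real N \<le> \<bar>y\<bar>" "N \<ge> 1"
  shows "real N powr (2 * s) \<le> (1 + y\<^sup>2) powr s"
proof -
  have "(real N)\<^sup>2 \<le> y\<^sup>2" using assms by (metis abs_le_square_iff abs_of_nat)
  then have "((real N)\<^sup>2) powr s \<le> (1 + y\<^sup>2) powr s" using assms by (intro powr_mono2) auto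
  moreover have "((real N)\<^sup>2) powr s = real N powr (2 * s)"
    using assms by (simp add: powr_powr flip: powr_numeral)
  ultimately show ?thesis by simp
qed

lemma sobolev_tail_sq_le:
  assumes "in_Hs s f" "finite A" "0 \<le> s" "N \<ge> 1" "\<And>k. k \<in> A \<Longrightarrow> int N < \<bar>k\<bar>"
  shows "(\<Sum>k\<in>A. (norm (fcoef f k))\<^sup>2) \<le> real N powr (- 2 * s) * (Hs_norm s f)\<^sup>2"
proof -
  have "(\<Sum>k\<in>A. (norm (fcoef f k))\<^sup>2)
      \<le> (\<Sum>k\<in>A. real N powr (- 2 * s) * ((1 + (of_int k)\<^sup>2) powr s * (norm (fcoef f k))\<^sup>2))"
  proof (rule sum_mono)
    fix k assume "k \<in> A"
    have "real N \<le> \<bar>real_of_int k\<bar>" using assms(5)[OF \<open>k \<in> A\<close>] by linarith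
    then have "1 \<le> real N powr (- 2 * s) * (1 + (real_of_int k)\<^sup>2) powr s"
      using powr_le_sobolev_weight[of s N "real_of_int k"] assms(3,4)
      by (simp add: powr_minus field_simps)
    from mult_right_mono[OF this, of "(norm (fcoef f k))\<^sup>2"]
    show "(norm (fcoef f k))\<^sup>2 \<le> real N powr (- 2 * s) * ((1 + (of_int k)\<^sup>2) powr s * (norm (fcoef f k))\<^sup>2)"
      by (simp add: mult.assoc)
  qed
  also have "\<dots> \<le> real N powr (- 2 * s) * (Hs_norm s f)\<^sup>2"
    unfolding sum_distrib_left[symmetric] using sobolev_sum_le[OF assms(1,2)] by (intro mult_left_mono) auto
  finally show ?thesis .
qed

text \<open>Cauchy-Schwarz against the \<open>2N\<close> modes in the octave, each of weight \<open>\<bar>k\<bar>\<^sup>2 (1 + k\<^sup>2)\<^sup>-\<^sup>s \<le> N\<^sup>2\<^sup>-\<^sup>2\<^sup>s\<close>.\<close>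

lemma sobolev_octave_le:
  assumes "in_Hs s f" "1 \<le> s" "N \<ge> 1"
  shows "(\<Sum>k\<in>{-int (2*N)..int (2*N)} - {-int N..int N}. \<bar>of_int k\<bar> * norm (fcoef f k))
    \<le> sqrt 2 * real N powr (3/2 - s) * Hs_norm s f"
proof -
  let ?A = "{-int (2*N)..int (2*N)} - {-int N..int N}"
  let ?W = "\<lambda>k::int. (1 + (real_of_int k)\<^sup>2) powr s"
  have card: "card ?A = 2 * N" by (subst card_Diff_subset) auto
  have "(\<Sum>k\<in>?A. \<bar>real_of_int k\<bar> * norm (fcoef f k))\<^sup>2
      = (\<Sum>k\<in>?A. (\<bar>real_of_int k\<bar> / sqrt (?W k)) * (sqrt (?W k) * norm (fcoef f k)))\<^sup>2"
    by (intro arg_cong[where f="\<lambda>x. x\<^sup>2"] sum.cong refl) (simp add: add_nonneg_eq_0_iff)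
  also have "\<dots> \<le> (\<Sum>k\<in>?A. (\<bar>real_of_int k\<bar> / sqrt (?W k))\<^sup>2) * (\<Sum>k\<in>?A. (sqrt (?W k) * norm (fcoef f k))\<^sup>2)"
    by (rule Cauchy_Schwarz_ineq_sum)
  also have "\<dots> \<le> (real (2 * N) * real N powr (2 - 2 * s)) * (Hs_norm s f)\<^sup>2"
  proof (rule mult_mono)
    have "(\<bar>real_of_int k\<bar> / sqrt (?W k))\<^sup>2 \<le> real N powr (2 - 2 * s)" if "k \<in> ?A" for k
    proof -
      have k: "real N \<le> \<bar>real_of_int k\<bar>" using that by auto
      have "(\<bar>real_of_int k\<bar> / sqrt (?W k))\<^sup>2 = (real_of_int k)\<^sup>2 / ?W k"
        by (simp add: power_divide)
      \<comment> \<open>Enlarging the numerator to the base of the weight leaves a single power,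
        whose exponent \<open>s - 1\<close> is nonnegative.\<close>
      also have "\<dots> \<le> (1 + (real_of_int k)\<^sup>2) / ?W k" by (intro divide_right_mono) auto
      also have "\<dots> = 1 / (1 + (real_of_int k)\<^sup>2) powr (s - 1)"
        by (simp add: powr_diff add_nonneg_eq_0_iff)
      also have "\<dots> \<le> 1 / real N powr (2 * (s - 1))"
        using powr_le_sobolev_weight[of "s - 1" N "real_of_int k"] k assms
          by (intro divide_left_mono) (auto simp: add_nonneg_eq_0_iff intro!: mult_pos_pos)
      also have "\<dots> = real N powr (2 - 2 * s)"
        using powr_minus_divide[of "real N" "2 * (s - 1)"] by (simp add: algebra_simps)
      finally show ?thesis .
    qed
    then show "(\<Sum>k\<in>?A. (\<bar>real_of_int k\<bar> / sqrt (?W k))\<^sup>2) \<le> real (2 * N) * real N powr (2 - 2 * s)"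
      using sum_bounded_above[of ?A "\<lambda>k. (\<bar>real_of_int k\<bar> / sqrt (?W k))\<^sup>2"] card by simp
    show "(\<Sum>k\<in>?A. (sqrt (?W k) * norm (fcoef f k))\<^sup>2) \<le> (Hs_norm s f)\<^sup>2"
      using sobolev_sum_le[OF assms(1), of ?A] by (simp add: power_mult_distrib)
  qed (auto intro!: sum_nonneg)
  \<comment> \<open>The number of modes contributes an extra factor \<open>N\<close>, so that
    \<open>N^(2 - 2s)\<close> becomes \<open>N^(3 - 2s)\<close>; its square root is the rate of the
    theorem.\<close>
  also have "\<dots> = (sqrt 2 * real N powr (3/2 - s) * Hs_norm s f)\<^sup>2"
  proof -
    have "(real N powr (3/2 - s))\<^sup>2 = real N powr (3 - 2 * s)"
      using assms by (simp add: power2_eq_square powr_add[symmetric])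
    also have "\<dots> = real N * real N powr (2 - 2 * s)"
      using assms powr_add[of "real N" 1 "2 - 2 * s"] by simp
    finally show ?thesis by (simp add: power_mult_distrib)
  qed
  finally show ?thesis
    by (rule power2_le_imp_le) (simp add: Hs_norm_nonneg)
qed

text \<open>The error at \<open>N\<close> is the error at a larger degree \<open>K\<close> plus the
  finite block of modes in between. The cosine kernel and best approximation make the former at most
  \<open>e\<close>; the Sobolev weight bounds the latter independently of \<open>K\<close>.\<close>

lemma fourier_tail_le:
  fixes f :: "real \<Rightarrow> real"
  assumes cont: "uniformly_continuous_on UNIV f" and per: "\<And>x. f (x + 2*pi) = f x"
    and bd: "\<And>x. \<bar>f x\<bar> \<le> M"
    and s: "in_Hs s (\<lambda>x. of_real (f x))" "0 \<le> s" and N: "N \<ge> 1"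
  shows "integral {0..2*pi} (\<lambda>x. (f x)\<^sup>2)
      - 2 * pi * (\<Sum>k\<in>{-int N..int N}. (norm (fcoef (\<lambda>x. of_real (f x)) k))\<^sup>2)
    \<le> 2 * pi * (real N powr (- 2 * s) * (Hs_norm s (\<lambda>x. of_real (f x)))\<^sup>2)"
proof (rule field_le_epsilon)
  fix e :: real assume e: "0 < e"
  let ?f = "\<lambda>x. complex_of_real (f x)"
  have cf: "continuous_on S f" for S
    using uniformly_continuous_imp_continuous[OF cont] by (rule continuous_on_subset) simp
  \<comment> \<open>Chosen so that \<open>2 * pi * (2 * \<eta>)^2 = e\<close>.\<close>
  define \<eta> where "\<eta> = sqrt (e / (2 * pi)) / 2"
  have "0 < \<eta>" using e by (simp add: \<eta>_def)
  then obtain d where d: "0 < d" "\<And>x y. dist x y < d \<Longrightarrow> dist (f x) (f y) < \<eta>"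
    using cont unfolding uniformly_continuous_on_def by (metis UNIV_I)
  obtain n where n: "\<And>N g x. n \<le> N \<Longrightarrow> continuous_on UNIV g \<Longrightarrow> (\<And>x. g (x + 2*pi) = g x) \<Longrightarrow>
      (\<And>x. norm (g x) \<le> M) \<Longrightarrow> (\<And>x y. \<bar>x - y\<bar> < d \<Longrightarrow> norm (g x - g y) \<le> \<eta>) \<Longrightarrow>
      norm (trig N (\<lambda>k. of_real (cos_mult n k) * fcoef g k) x - g x) \<le> 2 * \<eta>"
    using uniform_trig_approx[OF d(1) \<open>0 < \<eta>\<close>, of M] by blast
  \<comment> \<open>\<open>n \<le> K\<close> admits the approximant, \<open>N \<le> K\<close> the
    splitting of the sum.\<close>
  define K where "K = max n N"
  have approx: "norm (trig K (\<lambda>k. of_real (cos_mult n k) * fcoef ?f k) x - ?f x) \<le> 2 * \<eta>" for x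
  proof (rule n)
    show "norm (?f x - ?f y) \<le> \<eta>" if "\<bar>x - y\<bar> < d" for x y
      using d(2)[of x y] that by (simp add: dist_real_def flip: of_real_diff)
  qed (auto simp: K_def per bd intro!: continuous_intros cf)
  have "integral {0..2*pi} (\<lambda>x. (f x)\<^sup>2) - 2 * pi * (\<Sum>k\<in>{-int K..int K}. (norm (fcoef ?f k))\<^sup>2)
      \<le> integral {0..2*pi} (\<lambda>x. (norm (trig K (\<lambda>k. of_real (cos_mult n k) * fcoef ?f k) x - of_real (f x)))\<^sup>2)"
    by (rule fourier_best_approx[OF cf])
  also have "\<dots> \<le> integral {0..2*pi} (\<lambda>x. (2 * \<eta>)\<^sup>2)"
    by (intro integral_le integrable_continuous_real continuous_intros cf power_mono approx) auto
  also have "\<dots> = e" using e by (simp add: \<eta>_def)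
  finally have 1: "integral {0..2*pi} (\<lambda>x. (f x)\<^sup>2) \<le> 2 * pi * (\<Sum>k\<in>{-int K..int K}. (norm (fcoef ?f k))\<^sup>2) + e"
    by simp
  have "(\<Sum>k\<in>{-int K..int K}. (norm (fcoef ?f k))\<^sup>2)
      = (\<Sum>k\<in>{-int K..int K} - {-int N..int N}. (norm (fcoef ?f k))\<^sup>2) + (\<Sum>k\<in>{-int N..int N}. (norm (fcoef ?f k))\<^sup>2)"
    by (rule sum.subset_diff) (auto simp: K_def)
  also have "\<dots> \<le> real N powr (- 2 * s) * (Hs_norm s ?f)\<^sup>2 + (\<Sum>k\<in>{-int N..int N}. (norm (fcoef ?f k))\<^sup>2)"
    using s N by (intro add_right_mono sobolev_tail_sq_le) auto
  finally have "2 * pi * (\<Sum>k\<in>{-int K..int K}. (norm (fcoef ?f k))\<^sup>2)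
      \<le> 2 * pi * (real N powr (- 2 * s) * (Hs_norm s ?f)\<^sup>2 + (\<Sum>k\<in>{-int N..int N}. (norm (fcoef ?f k))\<^sup>2))"
    by (intro mult_left_mono) auto
  with 1 show "integral {0..2*pi} (\<lambda>x. (f x)\<^sup>2) - 2 * pi * (\<Sum>k\<in>{-int N..int N}. (norm (fcoef ?f k))\<^sup>2)
      \<le> 2 * pi * (real N powr (- 2 * s) * (Hs_norm s ?f)\<^sup>2) + e"
    by (simp add: distrib_left)
qed

text \<open>Later only the degree of the product matters, so its coefficients, a discrete
  convolution, stay existential.\<close>

lemma trig_mult:
  obtains d where "\<And>x. trig N c x * trig M e x = trig (N + M) d x"
proof
  fix x
  let ?d = "\<lambda>m. \<Sum>k\<in>{-int N..int N}. \<Sum>l\<in>{-int M..int M}. if m = k + l then c k * e l else 0"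
  have "trig (N + M) ?d x = (\<Sum>m\<in>{-int (N+M)..int (N+M)}. \<Sum>k\<in>{-int N..int N}. \<Sum>l\<in>{-int M..int M}.
      if m = k + l then c k * e l * cis (of_int (k + l) * x) else 0)"
    unfolding trig_def sum_distrib_right by (intro sum.cong refl) auto
  also have "\<dots> = (\<Sum>k\<in>{-int N..int N}. \<Sum>m\<in>{-int (N+M)..int (N+M)}. \<Sum>l\<in>{-int M..int M}.
      if m = k + l then c k * e l * cis (of_int (k + l) * x) else 0)"
    by (rule sum.swap)
  also have "\<dots> = (\<Sum>k\<in>{-int N..int N}. \<Sum>l\<in>{-int M..int M}. \<Sum>m\<in>{-int (N+M)..int (N+M)}.
      if m = k + l then c k * e l * cis (of_int (k + l) * x) else 0)"
    by (rule sum.cong[OF refl]) (rule sum.swap)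
  also have "\<dots> = (\<Sum>k\<in>{-int N..int N}. \<Sum>l\<in>{-int M..int M}. c k * e l * cis (of_int (k + l) * x))"
    by (intro sum.cong refl) (auto simp: sum.delta)
  also have "\<dots> = trig N c x * trig M e x"
    unfolding trig_def sum_product by (intro sum.cong refl) (simp add: distrib_right flip: cis_mult)
  finally show "trig N c x * trig M e x = trig (N + M) ?d x" by (rule sym)
qed

section \<open>The smooth solution: Fourier coefficients, energy and the sup norm of the
  slope\<close>

text \<open>One constant \<open>M\<close> bounds both \<open>u\<close> and \<open>ux\<close>. The
  Hoelder condition is supplied separately, in \<open>holder_equicontinuous\<close>.\<close>

locale smooth_burgers =
  fixes u ux :: "real \<Rightarrow> real \<Rightarrow> real" and T M :: real
  assumes T_pos: "0 < T"
    and periodic: "\<And>x t. u (x + 2*pi) t = u x t"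
    and u_cont: "continuous_on (UNIV \<times> {0..T}) (\<lambda>(x, t). u x t)"
    and ux_cont: "continuous_on (UNIV \<times> {0..T}) (\<lambda>(x, t). ux x t)"
    and ux_deriv: "\<And>x t. t \<in> {0..T} \<Longrightarrow> ((\<lambda>y. u y t) has_real_derivative ux x t) (at x)"
    and u_le: "\<And>x t. t \<in> {0..T} \<Longrightarrow> \<bar>u x t\<bar> \<le> M"
    and ux_le: "\<And>x t. t \<in> {0..T} \<Longrightarrow> \<bar>ux x t\<bar> \<le> M"
    and burgers: "\<And>x t. t \<in> {0..T} \<Longrightarrow>
        ((\<lambda>\<tau>. u x \<tau>) has_real_derivative (- (u x t * ux x t))) (at t within {0..T})"
begin

lemma M_nonneg: "0 \<le> M"
  using u_le[of 0 0] T_pos by simp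

lemma continuous_on_u: "t \<in> {0..T} \<Longrightarrow> continuous_on S (\<lambda>x. u x t)"
  by (rule continuous_on_compose2[OF u_cont, of S "\<lambda>x. (x, t)", unfolded prod.case])
    (auto intro!: continuous_intros)

lemma continuous_on_ux: "t \<in> {0..T} \<Longrightarrow> continuous_on S (\<lambda>x. ux x t)"
  by (rule continuous_on_compose2[OF ux_cont, of S "\<lambda>x. (x, t)", unfolded prod.case])
    (auto intro!: continuous_intros)

lemma continuous_on_u_swap: "continuous_on ({0..T} \<times> S) (\<lambda>p. u (snd p) (fst p))"
  by (rule continuous_on_compose2[OF u_cont, of "{0..T} \<times> S" "\<lambda>p. (snd p, fst p)", unfolded prod.case])
    (auto intro!: continuous_intros)

lemma continuous_on_ux_swap: "continuous_on ({0..T} \<times> S) (\<lambda>p. ux (snd p) (fst p))"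
  by (rule continuous_on_compose2[OF ux_cont, of "{0..T} \<times> S" "\<lambda>p. (snd p, fst p)", unfolded prod.case])
    (auto intro!: continuous_intros)

lemma ux_periodic:
  assumes t: "t \<in> {0..T}"
  shows "ux (x + 2*pi) t = ux x t"
proof -
  have "((\<lambda>y. u (y + 2*pi) t) has_real_derivative ux (x + 2*pi) t) (at x)"
    using ux_deriv[OF t, of "x + 2*pi"] by (simp only: DERIV_shift)
  then show ?thesis
    unfolding periodic using ux_deriv[OF t, of x] by (rule DERIV_unique)
qed

definition U :: "real \<Rightarrow> int \<Rightarrow> complex" where "U t = fcoef (\<lambda>x. of_real (u x t))"

definition Ux :: "real \<Rightarrow> int \<Rightarrow> complex" where "Ux t = fcoef (\<lambda>x. of_real (ux x t))"

definition P :: "real \<Rightarrow> int \<Rightarrow> complex" where "P t = fcoef (\<lambda>x. of_real (u x t * ux x t))"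

text \<open>Differentiation under the integral, legitimate because \<open>u * ux\<close> is jointly
  continuous in time and space.\<close>

lemma U_deriv:
  assumes t: "t \<in> {0..T}"
  shows "((\<lambda>\<tau>. U \<tau> k) has_vector_derivative - P t k) (at t within {0..T})"
proof -
  let ?f = "\<lambda>\<tau> x. complex_of_real (u x \<tau>) * cis (- (of_int k * x))"
  let ?f' = "\<lambda>\<tau> x. complex_of_real (- (u x \<tau> * ux x \<tau>)) * cis (- (of_int k * x))"
  have "((\<lambda>\<tau>. integral (cbox 0 (2*pi)) (?f \<tau>)) has_vector_derivative integral (cbox 0 (2*pi)) (?f' t))
      (at t within {0..T})"
  proof (rule leibniz_rule_vector_derivative)
    fix \<tau> x assume \<tau>: "\<tau> \<in> {0..T}"
    show "((\<lambda>\<tau>. ?f \<tau> x) has_vector_derivative ?f' \<tau> x) (at \<tau> within {0..T})"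
      by (intro has_vector_derivative_mult_left has_vector_derivative_of_real burgers \<tau>)
    show "?f \<tau> integrable_on cbox 0 (2*pi)"
      by (intro integrable_continuous continuous_intros continuous_on_u \<tau>)
  next
    show "continuous_on ({0..T} \<times> cbox 0 (2*pi)) (\<lambda>(\<tau>, x). ?f' \<tau> x)"
      unfolding case_prod_beta by (intro continuous_intros continuous_on_u_swap continuous_on_ux_swap)
  qed (use t in auto)
  from has_vector_derivative_divide[OF this, of "of_real (2*pi)"]
  show ?thesis
    by (simp add: U_def P_def fcoef_def)
qed

lemma integral_u_sq_ux:
  assumes t: "t \<in> {0..T}"
  shows "integral {0..2*pi} (\<lambda>x. (u x t)\<^sup>2 * ux x t) = 0"
proof -
  have "((\<lambda>x. (u x t) ^ 3 / 3) has_real_derivative (u x t)\<^sup>2 * ux x t) (at x within S)" for x S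
    using DERIV_cdivide[OF DERIV_power[OF has_field_derivative_at_within[OF ux_deriv[OF t, of x], of S], of 3], of 3]
    by (simp add: mult.commute[of "(u x t)\<^sup>2"])
  then have "((\<lambda>x. (u x t)\<^sup>2 * ux x t) has_integral (u (2*pi) t) ^ 3 / 3 - (u 0 t) ^ 3 / 3) {0..2*pi}"
    by (intro fundamental_theorem_of_calculus) (auto simp flip: has_real_derivative_iff_has_vector_derivative)
  moreover have "u (2*pi) t = u 0 t" using periodic[of 0 t] by simp
  ultimately show ?thesis by (simp add: integral_unique)
qed

text \<open>Conservation of energy: the time derivative of \<open>u^2\<close> is
  \<open>- 2 u^2 u_x\<close>, the space derivative of a multiple of \<open>u^3\<close>.\<close>

lemma integral_u_sq_deriv:
  assumes t: "t \<in> {0..T}"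
  shows "((\<lambda>\<tau>. integral {0..2*pi} (\<lambda>x. (u x \<tau>)\<^sup>2)) has_real_derivative 0) (at t within {0..T})"
proof -
  let ?f' = "\<lambda>\<tau> x. 2 * u x \<tau> * - (u x \<tau> * ux x \<tau>)"
  have "((\<lambda>\<tau>. integral (cbox 0 (2*pi)) (\<lambda>x. (u x \<tau>)\<^sup>2)) has_vector_derivative integral (cbox 0 (2*pi)) (?f' t))
      (at t within {0..T})"
  proof (rule leibniz_rule_vector_derivative)
    fix \<tau> x assume \<tau>: "\<tau> \<in> {0..T}"
    show "((\<lambda>\<tau>. (u x \<tau>)\<^sup>2) has_vector_derivative ?f' \<tau> x) (at \<tau> within {0..T})"
      using DERIV_power[OF burgers[OF \<tau>], of x 2]
      by (simp add: has_real_derivative_iff_has_vector_derivative mult_ac)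
    show "(\<lambda>x. (u x \<tau>)\<^sup>2) integrable_on cbox 0 (2*pi)"
      by (intro integrable_continuous continuous_intros continuous_on_u \<tau>)
  next
    show "continuous_on ({0..T} \<times> cbox 0 (2*pi)) (\<lambda>(\<tau>, x). ?f' \<tau> x)"
      unfolding case_prod_beta by (intro continuous_intros continuous_on_u_swap continuous_on_ux_swap)
  qed (use t in auto)
  moreover have "integral {0..2*pi} (?f' t) = integral {0..2*pi} (\<lambda>x. - 2 * ((u x t)\<^sup>2 * ux x t))"
    by (intro integral_cong) (simp add: power2_eq_square)
  ultimately show ?thesis
    by (simp add: has_real_derivative_iff_has_vector_derivative integral_u_sq_ux[OF t])
qed

text \<open>Integration by parts; the boundary terms cancel by periodicity.\<close>

lemma Ux_eq:
  assumes t: "t \<in> {0..T}"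
  shows "Ux t k = \<i> * of_int k * U t k"
proof -
  let ?e = "\<lambda>x. cis (- (of_int k * x))"
  have "((\<lambda>x. of_real (u x t) * ?e x) has_vector_derivative
      of_real (u x t) * (- (\<i> * of_int k) * ?e x) + of_real (ux x t) * ?e x) (at x within S)" for x S
  proof (intro has_vector_derivative_mult has_vector_derivative_of_real)
    show "((\<lambda>x. u x t) has_real_derivative ux x t) (at x within S)"
      by (rule has_field_derivative_at_within[OF ux_deriv[OF t]])
    show "(?e has_vector_derivative - (\<i> * of_int k) * ?e x) (at x within S)"
      using has_vector_derivative_cis[of "- of_int k" x S] by simp
  qed
  then have "((\<lambda>x. of_real (u x t) * (- (\<i> * of_int k) * ?e x) + of_real (ux x t) * ?e x) has_integral
      of_real (u (2*pi) t) * ?e (2*pi) - of_real (u 0 t) * ?e 0) {0..2*pi}"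
    by (intro fundamental_theorem_of_calculus) auto
  moreover have "u (2*pi) t = u 0 t" using periodic[of 0 t] by simp
  moreover have "?e (2*pi) = ?e 0" using cis_multiple_2pi[of "- of_int k"] by (simp add: mult_ac cis_zero)
  ultimately have "integral {0..2*pi} (\<lambda>x. of_real (u x t) * (- (\<i> * of_int k) * ?e x) + of_real (ux x t) * ?e x) = 0"
    by (simp add: integral_unique)
  also have "integral {0..2*pi} (\<lambda>x. of_real (u x t) * (- (\<i> * of_int k) * ?e x) + of_real (ux x t) * ?e x)
      = integral {0..2*pi} (\<lambda>x. - (\<i> * of_int k) * (of_real (u x t) * ?e x) + of_real (ux x t) * ?e x)"
    by (simp add: mult_ac)
  also have "\<dots> = - (\<i> * of_int k) * integral {0..2*pi} (\<lambda>x. of_real (u x t) * ?e x)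
      + integral {0..2*pi} (\<lambda>x. of_real (ux x t) * ?e x)"
    by (subst integral_add, (intro integrable_continuous_real continuous_intros continuous_on_u continuous_on_ux t)+)
      (simp only: integral_mult_right)
  finally show ?thesis by (simp add: Ux_def U_def fcoef_def field_simps)
qed

lemma uniformly_continuous_on_u:
  assumes t: "t \<in> {0..T}"
  shows "uniformly_continuous_on UNIV (\<lambda>x. u x t)"
proof -
  have "\<bar>u x t - u y t\<bar> \<le> M * \<bar>x - y\<bar>" for x y
    using field_differentiable_bound[of UNIV "\<lambda>x. u x t" "\<lambda>x. ux x t" M x y] ux_deriv[OF t] ux_le[OF t] by simp
  then have "M-lipschitz_on UNIV (\<lambda>x. u x t)"
    by (intro lipschitz_onI) (auto simp: dist_real_def M_nonneg)
  then show ?thesis by (rule lipschitz_on_uniformly_continuous)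
qed

lemma ux_le_Linf: "t \<in> {0..T} \<Longrightarrow> \<bar>ux x t\<bar> \<le> Linf_norm (\<lambda>x. ux x t)"
  unfolding Linf_norm_def using ux_le by (intro cSUP_upper) (auto intro!: bdd_aboveI)

lemma Linf_le_M: "t \<in> {0..T} \<Longrightarrow> Linf_norm (\<lambda>x. ux x t) \<le> M"
  unfolding Linf_norm_def using ux_le by (intro cSUP_least) auto

text \<open>Gronwall differentiates the primitive of this function. The supremum reduces to one
  period, where \<open>ux\<close> is uniformly continuous jointly in time and space.\<close>

lemma continuous_on_Linf: "continuous_on {0..T} (\<lambda>t. Linf_norm (\<lambda>x. ux x t))"
proof -
  have "continuous_on ({0..T} \<times> {0..2*pi}) (\<lambda>p. ux (snd p) (fst p))" by (rule continuous_on_ux_swap)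
  then have uc: "uniformly_continuous_on ({0..T} \<times> {0..2*pi}) (\<lambda>p. ux (snd p) (fst p))"
    by (intro compact_uniformly_continuous compact_Times) auto
  have "uniformly_continuous_on {0..T} (\<lambda>t. Linf_norm (\<lambda>x. ux x t))"
    unfolding uniformly_continuous_on_def
  proof (intro allI impI)
    fix e :: real assume "0 < e"
    then have "0 < e / 2" by simp
    then obtain d where d: "0 < d" "\<And>p q. p \<in> {0..T} \<times> {0..2*pi} \<Longrightarrow> q \<in> {0..T} \<times> {0..2*pi} \<Longrightarrow>
        dist q p < d \<Longrightarrow> dist (ux (snd q) (fst q)) (ux (snd p) (fst p)) < e / 2"
      using uc unfolding uniformly_continuous_on_def by meson
    have le: "Linf_norm (\<lambda>x. ux x t) \<le> Linf_norm (\<lambda>x. ux x s) + e / 2"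
      if ts: "t \<in> {0..T}" "s \<in> {0..T}" "dist s t < d" for s t
    proof -
      have "\<bar>ux x t\<bar> \<le> Linf_norm (\<lambda>x. ux x s) + e / 2" for x
      proof -
        \<comment> \<open>Moves \<open>x\<close> by whole periods into the compact
          rectangle.\<close>
        define y where "y = x - 2*pi * of_int \<lfloor>x / (2*pi)\<rfloor>"
        have "0 \<le> y" "y \<le> 2*pi"
          using floor_divide_lower[of "2*pi" x] floor_divide_upper[of "2*pi" x] by (auto simp: y_def algebra_simps)
        then have "dist (ux y s) (ux y t) < e / 2"
          using d(2)[of "(t, y)" "(s, y)"] ts by (auto simp: dist_Pair_Pair)
        moreover have "ux x t = ux y t"
          using periodic_shift_int[of "\<lambda>x. ux x t" y "\<lfloor>x / (2*pi)\<rfloor>", OF ux_periodic[OF ts(1)]] by (simp add: y_def)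
        ultimately show ?thesis using ux_le_Linf[OF ts(2), of y] unfolding dist_real_def by linarith
      qed
      then show ?thesis unfolding Linf_norm_def[of "\<lambda>x. ux x t"] by (intro cSUP_least) auto
    qed
    show "\<exists>d>0. \<forall>t\<in>{0..T}. \<forall>s\<in>{0..T}. dist s t < d \<longrightarrow> dist (Linf_norm (\<lambda>x. ux x s)) (Linf_norm (\<lambda>x. ux x t)) < e"
    proof (intro exI conjI ballI impI)
      fix t s assume *: "t \<in> {0..T}" "s \<in> {0..T}" "dist s t < d"
      from le[of t s] le[of s t] * \<open>0 < e\<close>
      show "dist (Linf_norm (\<lambda>x. ux x s)) (Linf_norm (\<lambda>x. ux x t)) < e"
        by (simp add: dist_commute) (simp add: dist_real_def)
    qed (rule d(1))
  qed
  then show ?thesis by (rule uniformly_continuous_imp_continuous)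
qed

end

section \<open>Error estimates for the Galerkin approximation\<close>

locale burgers_galerkin = smooth_burgers u ux T M + galerkin N T w
  for u ux :: "real \<Rightarrow> real \<Rightarrow> real" and T M :: real and N :: nat and w :: "real \<Rightarrow> real \<Rightarrow> complex" +
  assumes init: "(\<lambda>x. w x 0) = PN N (\<lambda>x. complex_of_real (u x 0))"
begin

lemma a_init: "\<bar>k\<bar> \<le> int N \<Longrightarrow> a 0 k = U 0 k"
  unfolding a_def init PN_eq_trig fcoef_trig by (simp add: U_def)

text \<open>Conservation carries the bound over from the initial value, where Bessel's inequality
  compares the truncated data with \<open>u\<close>. The result is independent of
  \<open>N\<close>.\<close>

lemma energy_w:
  assumes t: "t \<in> {0..T}"
  shows "integral {0..2*pi} (\<lambda>x. (Re (w x t))\<^sup>2) \<le> 2 * pi * M\<^sup>2"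
proof -
  have 0: "0 \<in> {0..T}" using T_pos by simp
  have "integral {0..2*pi} (\<lambda>x. (Re (w x t))\<^sup>2) = integral {0..2*pi} (\<lambda>x. (norm (trig N (a t) x))\<^sup>2)"
    by (intro integral_cong) (simp add: cmod_power2 w_real[OF t] flip: w_eq[OF t])
  also have "\<dots> = 2 * pi * (\<Sum>k\<in>{-int N..int N}. (norm (a 0 k))\<^sup>2)"
    by (simp only: integral_norm_trig energy_conserved[OF t])
  also have "(\<Sum>k\<in>{-int N..int N}. (norm (a 0 k))\<^sup>2) = (\<Sum>k\<in>{-int N..int N}. (norm (U 0 k))\<^sup>2)"
    by (intro sum.cong refl) (auto simp: a_init)
  also have "2 * pi * \<dots> \<le> integral {0..2*pi} (\<lambda>x. (u x 0)\<^sup>2)"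
  proof -
    have *: "Re (z * cnj z) = (norm z)\<^sup>2" for z by (simp add: complex_norm_square[symmetric] del: of_real_power)
    \<comment> \<open>Expanding the nonnegative squared projection error yields Bessel's
      inequality.\<close>
    have "0 \<le> integral {0..2*pi} (\<lambda>x. (norm (trig N (U 0) x - of_real (u x 0)))\<^sup>2)"
      by (intro integral_nonneg integrable_continuous_real continuous_intros continuous_on_u 0) auto
    then show ?thesis
      unfolding integral_norm_trig_diff[OF continuous_on_u[OF 0]] U_def * by simp
  qed
  also have "\<dots> \<le> integral {0..2*pi} (\<lambda>x. M\<^sup>2)"
    using u_le[OF 0] by (intro integral_le integrable_continuous_real continuous_intros continuous_on_u 0)
      (simp add: abs_le_square_iff[symmetric] M_nonneg)
  finally show ?thesis by simp
qed

lemma integral_w_mult: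
  assumes t: "t \<in> {0..T}" and g: "continuous_on {0..2*pi} g"
  shows "integral {0..2*pi} (\<lambda>x. Re (w x t) * Re (g x))
    = 2 * pi * (\<Sum>k\<in>{-int N..int N}. Re (fcoef g k * cnj (a t k)))"
proof -
  have "integral {0..2*pi} (\<lambda>x. Re (w x t) * Re (g x)) = integral {0..2*pi} (\<lambda>x. Re (g x * cnj (trig N (a t) x)))"
    by (intro integral_cong) (simp add: w_real[OF t] flip: w_eq[OF t])
  also have "\<dots> = Re (integral {0..2*pi} (\<lambda>x. g x * cnj (trig N (a t) x)))"
    by (rule Re_integral[symmetric]) (intro continuous_intros g)
  finally show ?thesis unfolding integral_mult_cnj_trig[OF g] by (simp only: Re_of_real_mult Re_sum)
qed

text \<open>The square has degree at most \<open>2 * N\<close>, so its own coefficients reproduce it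
  when summed that far.\<close>

lemma w_squared: "t \<in> {0..T} \<Longrightarrow> (w x t)\<^sup>2 = trig (2 * N) (b t) x"
proof -
  assume t: "t \<in> {0..T}"
  obtain d where d: "\<And>x. trig N (a t) x * trig N (a t) x = trig (N + N) d x" using trig_mult by blast
  have eq: "(w x t)\<^sup>2 = trig (2 * N) d x" for x
    using d[of x] by (simp add: power2_eq_square w_eq[OF t] mult_2)
  have "b t k = (if \<bar>k\<bar> \<le> int (2 * N) then d k else 0)" for k unfolding b_def eq fcoef_trig ..
  then have "trig (2 * N) (b t) x = trig (2 * N) d x" unfolding trig_def by (intro sum.cong refl) auto
  then show ?thesis using eq by simp
qed

lemma integral_w_squared_mult:
  assumes t: "t \<in> {0..T}" and g: "continuous_on {0..2*pi} g"
  shows "integral {0..2*pi} (\<lambda>x. (Re (w x t))\<^sup>2 * Re (g x))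
    = 2 * pi * (\<Sum>k\<in>{-int (2*N)..int (2*N)}. Re (fcoef g k * cnj (b t k)))"
proof -
  have "integral {0..2*pi} (\<lambda>x. (Re (w x t))\<^sup>2 * Re (g x)) = integral {0..2*pi} (\<lambda>x. Re (g x * cnj (trig (2*N) (b t) x)))"
    by (intro integral_cong) (simp add: w_real[OF t] power2_eq_square flip: w_squared[OF t])
  also have "\<dots> = Re (integral {0..2*pi} (\<lambda>x. g x * cnj (trig (2*N) (b t) x)))"
    by (rule Re_integral[symmetric]) (intro continuous_intros g)
  finally show ?thesis unfolding integral_mult_cnj_trig[OF g] by (simp only: Re_of_real_mult Re_sum)
qed

text \<open>A test polynomial of degree \<open>N\<close> only sees the projected square, the one in
  the Galerkin equation.\<close>

lemma integral_w_squared_mult_trig: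
  assumes t: "t \<in> {0..T}"
  shows "integral {0..2*pi} (\<lambda>x. (Re (w x t))\<^sup>2 * Re (trig N c x))
    = 2 * pi * (\<Sum>k\<in>{-int N..int N}. Re (c k * cnj (b t k)))"
  unfolding integral_w_squared_mult[OF t continuous_on_trig] fcoef_trig
  by (intro arg_cong[where f="\<lambda>x. 2 * pi * x"] sum.mono_neutral_cong_right) auto

text \<open>A Fourier coefficient is at most the mean of \<open>w^2\<close>, which the energy
  controls uniformly in \<open>k\<close> and \<open>N\<close>.\<close>

lemma norm_b_le:
  assumes t: "t \<in> {0..T}"
  shows "norm (b t k) \<le> M\<^sup>2"
proof -
  have "norm (b t k) \<le> integral {0..2*pi} (\<lambda>x. norm ((w x t)\<^sup>2)) / (2*pi)"
    unfolding b_def by (intro norm_fcoef_le_integral continuous_intros continuous_on_w t)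
  also have "integral {0..2*pi} (\<lambda>x. norm ((w x t)\<^sup>2)) = integral {0..2*pi} (\<lambda>x. (Re (w x t))\<^sup>2)"
    by (intro integral_cong) (simp add: norm_power cmod_power2 w_real[OF t])
  also have "\<dots> / (2*pi) \<le> M\<^sup>2" using energy_w[OF t] by (simp add: field_simps)
  finally show ?thesis .
qed

definition err :: "real \<Rightarrow> real" where
  "err t = integral {0..2*pi} (\<lambda>x. (Re (w x t) - u x t)\<^sup>2)"

lemma err_eq_norm: "t \<in> {0..T} \<Longrightarrow> err t = integral {0..2*pi} (\<lambda>x. (norm (w x t - of_real (u x t)))\<^sup>2)"
  unfolding err_def by (intro integral_cong) (simp add: cmod_power2 w_real)

text \<open>The \<open>L\<^sup>2\<close> error, except that the inner product \<open>\<langle>w, u\<rangle>\<close> is replaced by \<open>\<langle>w, T u\<rangle>\<close> for the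
  Fourier multiplier \<open>T\<close> with symbol \<open>m\<close>.\<close>

definition F :: "(int \<Rightarrow> real) \<Rightarrow> real \<Rightarrow> real" where
  "F m t = 2 * pi * (\<Sum>k\<in>{-int N..int N}. (norm (a t k))\<^sup>2) + integral {0..2*pi} (\<lambda>x. (u x t)\<^sup>2)
    - 4 * pi * (\<Sum>k\<in>{-int N..int N}. Re (of_real (m k) * U t k * cnj (a t k)))"

text \<open>Because the sum stops at \<open>N\<close>, the constant symbol 1 stands for the
  projection. The real part matches the pairings, of which only real parts occur.\<close>

definition Tm :: "(int \<Rightarrow> real) \<Rightarrow> (int \<Rightarrow> complex) \<Rightarrow> real \<Rightarrow> real" where
  "Tm m c x = Re (trig N (\<lambda>k. of_real (m k) * c k) x)"

lemma continuous_on_Tm [continuous_intros]: "continuous_on S (Tm m c)"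
  unfolding Tm_def by (intro continuous_intros)

lemma continuous_on_Re_w: "t \<in> {0..T} \<Longrightarrow> continuous_on S (\<lambda>x. Re (w x t))"
  by (intro continuous_intros continuous_on_w)

lemma integral_w_mult_Tm:
  assumes t: "t \<in> {0..T}"
  shows "integral {0..2*pi} (\<lambda>x. Re (w x t) * Tm m c x)
    = 2 * pi * (\<Sum>k\<in>{-int N..int N}. Re (of_real (m k) * c k * cnj (a t k)))"
  unfolding Tm_def integral_w_mult[OF t continuous_on_trig] fcoef_trig
  by (intro arg_cong[where f="\<lambda>x. 2 * pi * x"] sum.cong refl) auto

text \<open>The definition of \<open>F\<close> suits differentiation; this form suits comparison
  with the error.\<close>

lemma F_eq:
  assumes t: "t \<in> {0..T}"
  shows "F m t = err t + 2 * integral {0..2*pi} (\<lambda>x. Re (w x t) * (u x t - Tm m (U t) x))"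
proof -
  have "err t = integral {0..2*pi} (\<lambda>x. (norm (trig N (a t) x - of_real (u x t)))\<^sup>2)"
    by (simp add: err_eq_norm[OF t] w_eq[OF t])
  also have "\<dots> = integral {0..2*pi} (\<lambda>x. (u x t)\<^sup>2)
      - 4 * pi * (\<Sum>k\<in>{-int N..int N}. Re (U t k * cnj (a t k)))
      + 2 * pi * (\<Sum>k\<in>{-int N..int N}. (norm (a t k))\<^sup>2)"
    unfolding integral_norm_trig_diff[OF continuous_on_u[OF t]] U_def ..
  finally have 1: "err t = \<dots>" .
  have 2: "integral {0..2*pi} (\<lambda>x. Re (w x t) * u x t) = 2 * pi * (\<Sum>k\<in>{-int N..int N}. Re (U t k * cnj (a t k)))"
    using integral_w_mult[OF t, of "\<lambda>x. of_real (u x t)"] continuous_on_u[OF t]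
    by (simp add: U_def continuous_on_of_real)
  have "integral {0..2*pi} (\<lambda>x. Re (w x t) * (u x t - Tm m (U t) x))
      = integral {0..2*pi} (\<lambda>x. Re (w x t) * u x t) - integral {0..2*pi} (\<lambda>x. Re (w x t) * Tm m (U t) x)"
    unfolding right_diff_distrib
    by (intro integral_diff integrable_continuous_real continuous_intros continuous_on_Re_w continuous_on_u t)
  then show ?thesis unfolding 1 2 integral_w_mult_Tm[OF t] F_def by simp
qed

text \<open>Both energies are constant, so only the pairing of \<open>w\<close> with
  \<open>T u\<close> varies; it contributes
  \<open>- \<integral> w^2 T u_x + 2 \<integral> w T (u u_x)\<close>. Adding and subtracting the
  integrals without \<open>T\<close> completes the square \<open>(w - u)^2 u_x\<close>, since
  \<open>u^2 u_x\<close> integrates to zero.\<close>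

lemma F_deriv:
  assumes t: "t \<in> {0..T}"
  shows "(F m has_real_derivative
      - integral {0..2*pi} (\<lambda>x. (Re (w x t) - u x t)\<^sup>2 * ux x t)
      + integral {0..2*pi} (\<lambda>x. (Re (w x t))\<^sup>2 * (ux x t - Tm m (Ux t) x))
      - 2 * integral {0..2*pi} (\<lambda>x. Re (w x t) * (u x t * ux x t - Tm m (P t) x))) (at t within {0..T})"
proof -
  let ?I = "{-int N..int N}"
  let ?a' = "\<lambda>k. - (\<i> * of_int k / 2) * b t k"
  note cont = integrable_continuous_real continuous_intros continuous_on_Re_w continuous_on_u continuous_on_ux t
  have "((\<lambda>\<tau>. of_real (m k) * U \<tau> k) has_vector_derivative of_real (m k) * (- P t k)) (at t within {0..T})" for k
    by (intro has_vector_derivative_mult_right U_deriv t)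
  then have "((\<lambda>\<tau>. \<Sum>k\<in>?I. Re (of_real (m k) * U \<tau> k * cnj (a \<tau> k))) has_real_derivative
      (\<Sum>k\<in>?I. Re (of_real (m k) * U t k * cnj (?a' k) + of_real (m k) * (- P t k) * cnj (a t k)))) (at t within {0..T})"
    by (intro DERIV_sum has_real_derivative_Re_mult_cnj a_deriv t) auto
  note * = this
  have "(F m has_real_derivative 0 + 0 - 4 * pi * (\<Sum>k\<in>?I. Re (of_real (m k) * U t k * cnj (?a' k)
      + of_real (m k) * (- P t k) * cnj (a t k)))) (at t within {0..T})"
    unfolding F_def[abs_def]
  proof (intro DERIV_diff DERIV_add integral_u_sq_deriv t DERIV_cmult *)
    show "((\<lambda>\<tau>. 2 * pi * (\<Sum>k\<in>?I. (norm (a \<tau> k))\<^sup>2)) has_real_derivative 0) (at t within {0..T})"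
      unfolding has_real_derivative_iff_has_vector_derivative
    proof (rule has_vector_derivative_transform[OF t _ has_vector_derivative_const])
      fix \<tau> assume \<tau>: "\<tau> \<in> {0..T}"
      show "2 * pi * (\<Sum>k\<in>?I. (norm (a \<tau> k))\<^sup>2) = 2 * pi * (\<Sum>k\<in>?I. (norm (a 0 k))\<^sup>2)"
        by (simp only: energy_conserved[OF \<tau>])
    qed
  qed
  \<comment> \<open>The factor \<open>k\<close> from the derivative of \<open>a\<close> is shifted
    onto \<open>U\<close>, so that the space derivative falls on \<open>u\<close>.\<close>
  moreover have "Re (of_real (m k) * U t k * cnj (?a' k) + of_real (m k) * (- P t k) * cnj (a t k))
      = 1/2 * Re (of_real (m k) * Ux t k * cnj (b t k)) - Re (of_real (m k) * P t k * cnj (a t k))" for k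
    by (simp add: Ux_eq[OF t] algebra_simps add_divide_distrib diff_divide_distrib)
  ultimately have D: "(F m has_real_derivative
      - (2 * pi * (\<Sum>k\<in>?I. Re (of_real (m k) * Ux t k * cnj (b t k))))
      + 2 * (2 * pi * (\<Sum>k\<in>?I. Re (of_real (m k) * P t k * cnj (a t k))))) (at t within {0..T})"
    by (simp only: sum_subtractf sum_distrib_left[symmetric]) (simp add: algebra_simps)
  have i1: "integral {0..2*pi} (\<lambda>x. (Re (w x t))\<^sup>2 * (ux x t - Tm m (Ux t) x))
      = integral {0..2*pi} (\<lambda>x. (Re (w x t))\<^sup>2 * ux x t) - integral {0..2*pi} (\<lambda>x. (Re (w x t))\<^sup>2 * Tm m (Ux t) x)"
    unfolding right_diff_distrib by (intro integral_diff cont)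
  have i2: "integral {0..2*pi} (\<lambda>x. Re (w x t) * (u x t * ux x t - Tm m (P t) x))
      = integral {0..2*pi} (\<lambda>x. Re (w x t) * (u x t * ux x t)) - integral {0..2*pi} (\<lambda>x. Re (w x t) * Tm m (P t) x)"
    unfolding right_diff_distrib by (intro integral_diff cont)
  have "integral {0..2*pi} (\<lambda>x. (Re (w x t) - u x t)\<^sup>2 * ux x t)
      = integral {0..2*pi} (\<lambda>x. ((Re (w x t))\<^sup>2 * ux x t - 2 * (Re (w x t) * (u x t * ux x t))) + (u x t)\<^sup>2 * ux x t)"
    by (intro integral_cong) (simp add: power2_eq_square algebra_simps)
  also have "\<dots> = integral {0..2*pi} (\<lambda>x. (Re (w x t))\<^sup>2 * ux x t)
      - 2 * integral {0..2*pi} (\<lambda>x. Re (w x t) * (u x t * ux x t)) + integral {0..2*pi} (\<lambda>x. (u x t)\<^sup>2 * ux x t)"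
    by (subst integral_add integral_diff, (intro cont)+)+ (simp only: integral_mult_right)
  finally have i3: "integral {0..2*pi} (\<lambda>x. (Re (w x t) - u x t)\<^sup>2 * ux x t) = \<dots>" .
  have i4: "integral {0..2*pi} (\<lambda>x. (Re (w x t))\<^sup>2 * Tm m (Ux t) x)
      = 2 * pi * (\<Sum>k\<in>?I. Re (of_real (m k) * Ux t k * cnj (b t k)))"
    unfolding Tm_def by (rule integral_w_squared_mult_trig[OF t])
  show ?thesis
    by (rule DERIV_cong[OF D]) (simp only: i1 i2 i3 i4 integral_w_mult_Tm[OF t] integral_u_sq_ux[OF t], simp)
qed

text \<open>\<open>L\<close> is left open: the sup norm of \<open>ux\<close> for the rate, the
  constant \<open>M\<close> for convergence. The defect \<open>e0\<close> is paid twice: in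
  replacing the error by \<open>F\<close> inside Gronwall, which costs \<open>2 * M * e0\<close>,
  and in returning to the error at \<open>t1\<close>. Defects are controlled up to
  \<open>t1\<close>, as far as the Sobolev bounds reach.\<close>

lemma stability:
  assumes L: "continuous_on {0..T} L" "\<And>x t. t \<in> {0..T} \<Longrightarrow> \<bar>ux x t\<bar> \<le> L t" "\<And>t. t \<in> {0..T} \<Longrightarrow> L t \<le> M"
    and e: "0 \<le> e0" "0 \<le> e1" "0 \<le> e2" and t1: "t1 \<in> {0..T}"
    and e0: "\<And>t. t \<in> {0..t1} \<Longrightarrow> \<bar>integral {0..2*pi} (\<lambda>x. Re (w x t) * (u x t - Tm m (U t) x))\<bar> \<le> e0"
    and e1: "\<And>t. t \<in> {0..t1} \<Longrightarrow> integral {0..2*pi} (\<lambda>x. (Re (w x t))\<^sup>2 * (ux x t - Tm m (Ux t) x)) \<le> e1"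
    and e2: "\<And>t. t \<in> {0..t1} \<Longrightarrow> - integral {0..2*pi} (\<lambda>x. Re (w x t) * (u x t * ux x t - Tm m (P t) x)) \<le> e2"
  shows "err t1 \<le> exp (integral {0..t1} L) * (F m 0 + (2 * M * e0 + e1 + 2 * e2) * t1) + 2 * e0"
proof -
  have sub: "t \<in> {0..T}" if "t \<in> {0..t1}" for t using that t1 by auto
  have L0: "0 \<le> L t" if "t \<in> {0..t1}" for t using L(2)[OF sub[OF that], of 0] by linarith
  have "F m t1 \<le> exp (integral {0..t1} L) * (F m 0 + (2 * M * e0 + e1 + 2 * e2) * t1)"
  proof (rule gronwall[where T=t1, OF _ _ L0])
    fix t assume t': "t \<in> {0..t1}"
    note t = sub[OF t']
    show "(F m has_real_derivative
      - integral {0..2*pi} (\<lambda>x. (Re (w x t) - u x t)\<^sup>2 * ux x t)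
      + integral {0..2*pi} (\<lambda>x. (Re (w x t))\<^sup>2 * (ux x t - Tm m (Ux t) x))
      - 2 * integral {0..2*pi} (\<lambda>x. Re (w x t) * (u x t * ux x t - Tm m (P t) x))) (at t within {0..t1})"
      by (rule DERIV_subset[OF F_deriv[OF t]]) (use t1 in auto)
    have "- integral {0..2*pi} (\<lambda>x. (Re (w x t) - u x t)\<^sup>2 * ux x t)
        = integral {0..2*pi} (\<lambda>x. - ((Re (w x t) - u x t)\<^sup>2 * ux x t))"
      by (simp only: integral_neg)
    also have "\<dots> \<le> integral {0..2*pi} (\<lambda>x. L t * (Re (w x t) - u x t)\<^sup>2)"
    proof (intro integral_le integrable_continuous_real continuous_intros continuous_on_w continuous_on_u continuous_on_ux t)
      fix x
      have "(Re (w x t) - u x t)\<^sup>2 * (- ux x t) \<le> (Re (w x t) - u x t)\<^sup>2 * L t"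
        using L(2)[OF t, of x] by (intro mult_left_mono) auto
      then show "- ((Re (w x t) - u x t)\<^sup>2 * ux x t) \<le> L t * (Re (w x t) - u x t)\<^sup>2"
        by (simp add: mult.commute)
    qed
    also have "\<dots> = L t * err t" by (simp add: err_def)
    also have "\<dots> \<le> L t * (F m t + 2 * e0)"
      using e0[OF t'] L0[OF t'] unfolding F_eq[OF t] by (intro mult_left_mono) linarith+
    also have "\<dots> \<le> L t * F m t + 2 * M * e0"
      using mult_right_mono[OF L(3)[OF t] e(1)] by (simp add: algebra_simps)
    finally show "- integral {0..2*pi} (\<lambda>x. (Re (w x t) - u x t)\<^sup>2 * ux x t)
      + integral {0..2*pi} (\<lambda>x. (Re (w x t))\<^sup>2 * (ux x t - Tm m (Ux t) x))
      - 2 * integral {0..2*pi} (\<lambda>x. Re (w x t) * (u x t * ux x t - Tm m (P t) x))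
      \<le> L t * F m t + (2 * M * e0 + e1 + 2 * e2)"
      using e1[OF t'] e2[OF t'] by linarith
  qed (use t1 e M_nonneg in \<open>auto intro: continuous_on_subset[OF L(1)]\<close>)
  moreover have "err t1 \<le> F m t1 + 2 * e0"
    using e0[of t1] t1 unfolding F_eq[OF t1] by auto
  ultimately show ?thesis by linarith
qed

text \<open>On the retained modes \<open>a\<close> and \<open>U\<close> agree initially, so the
  terms collapse to the squared projection error of \<open>fourier_tail_le\<close> and
  \<open>fourier_best_approx\<close>.\<close>

lemma F_init: "F (\<lambda>_. 1) 0 = integral {0..2*pi} (\<lambda>x. (u x 0)\<^sup>2)
    - 2 * pi * (\<Sum>k\<in>{-int N..int N}. (norm (U 0 k))\<^sup>2)"
proof -
  have *: "Re (z * cnj z) = (norm z)\<^sup>2" for z by (simp add: complex_norm_square[symmetric] del: of_real_power)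
  have "(\<Sum>k\<in>{-int N..int N}. (norm (a 0 k))\<^sup>2) = (\<Sum>k\<in>{-int N..int N}. (norm (U 0 k))\<^sup>2)"
    by (intro sum.cong refl) (auto simp: a_init)
  moreover have "(\<Sum>k\<in>{-int N..int N}. Re (of_real 1 * U 0 k * cnj (a 0 k))) = (\<Sum>k\<in>{-int N..int N}. (norm (U 0 k))\<^sup>2)"
    by (intro sum.cong refl) (simp only: a_init * of_real_1 mult_1_left abs_le_iff atLeastAtMost_iff minus_le_iff)
  ultimately show ?thesis unfolding F_def by simp
qed

text \<open>\<open>w\<close> lies in the range of the projection and is orthogonal to what the
  projection removes. For the rate this makes two of the three defects zero.\<close>

lemma integral_w_proj_zero:
  assumes t: "t \<in> {0..T}" and g: "continuous_on {0..2*pi} g"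
  shows "integral {0..2*pi} (\<lambda>x. Re (w x t) * (g x - Tm (\<lambda>_. 1) (fcoef (\<lambda>x. of_real (g x))) x)) = 0"
proof -
  have "integral {0..2*pi} (\<lambda>x. Re (w x t) * (g x - Tm (\<lambda>_. 1) (fcoef (\<lambda>x. of_real (g x))) x))
    = integral {0..2*pi} (\<lambda>x. Re (w x t) * g x) - integral {0..2*pi} (\<lambda>x. Re (w x t) * Tm (\<lambda>_. 1) (fcoef (\<lambda>x. of_real (g x))) x)"
    unfolding right_diff_distrib
    by (intro integral_diff integrable_continuous_real continuous_intros continuous_on_Re_w g t)
  also have "\<dots> = 0"
    using integral_w_mult[OF t, of "\<lambda>x. of_real (g x)"] g
    unfolding integral_w_mult_Tm[OF t] by (simp add: continuous_on_of_real)
  finally show ?thesis .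
qed

text \<open>Beyond \<open>2 * N\<close> the square has no modes, and up to \<open>N\<close> the
  projection cancels them. On the octave left over, \<open>Ux\<close> costs a factor
  \<open>k\<close> and \<open>b\<close> is bounded by the energy, so the bound is linear in the
  Sobolev norm.\<close>

lemma consistency_le:
  assumes t: "t \<in> {0..T}" and s: "1 \<le> s" "in_Hs s (\<lambda>x. of_real (u x t))" and N: "N \<ge> 1"
  shows "integral {0..2*pi} (\<lambda>x. (Re (w x t))\<^sup>2 * (ux x t - Tm (\<lambda>_. 1) (Ux t) x))
    \<le> 2 * pi * M\<^sup>2 * (sqrt 2 * real N powr (3/2 - s) * Hs_norm s (\<lambda>x. of_real (u x t)))"
proof -
  let ?A = "{-int (2*N)..int (2*N)} - {-int N..int N}"
  have "integral {0..2*pi} (\<lambda>x. (Re (w x t))\<^sup>2 * (ux x t - Tm (\<lambda>_. 1) (Ux t) x))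
      = integral {0..2*pi} (\<lambda>x. (Re (w x t))\<^sup>2 * ux x t) - integral {0..2*pi} (\<lambda>x. (Re (w x t))\<^sup>2 * Tm (\<lambda>_. 1) (Ux t) x)"
    unfolding right_diff_distrib
    by (intro integral_diff integrable_continuous_real continuous_intros continuous_on_Re_w continuous_on_ux t)
  also have "integral {0..2*pi} (\<lambda>x. (Re (w x t))\<^sup>2 * ux x t)
      = 2 * pi * (\<Sum>k\<in>{-int (2*N)..int (2*N)}. Re (Ux t k * cnj (b t k)))"
    using integral_w_squared_mult[OF t, of "\<lambda>x. of_real (ux x t)"] continuous_on_ux[OF t]
    by (simp add: Ux_def continuous_on_of_real)
  also have "integral {0..2*pi} (\<lambda>x. (Re (w x t))\<^sup>2 * Tm (\<lambda>_. 1) (Ux t) x)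
      = 2 * pi * (\<Sum>k\<in>{-int N..int N}. Re (Ux t k * cnj (b t k)))"
    unfolding Tm_def integral_w_squared_mult_trig[OF t] by simp
  also have "2 * pi * (\<Sum>k\<in>{-int (2*N)..int (2*N)}. Re (Ux t k * cnj (b t k)))
      - 2 * pi * (\<Sum>k\<in>{-int N..int N}. Re (Ux t k * cnj (b t k)))
      = 2 * pi * (\<Sum>k\<in>?A. Re (Ux t k * cnj (b t k)))"
    unfolding right_diff_distrib[symmetric] by (subst sum_diff) auto
  also have "\<dots> \<le> 2 * pi * (\<Sum>k\<in>?A. M\<^sup>2 * (\<bar>of_int k\<bar> * norm (U t k)))"
  proof (intro mult_left_mono sum_mono)
    fix k
    have "Re (Ux t k * cnj (b t k)) \<le> norm (Ux t k) * norm (b t k)"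
      using complex_Re_le_cmod[of "Ux t k * cnj (b t k)"] by (simp add: norm_mult)
    also have "\<dots> \<le> norm (Ux t k) * M\<^sup>2" by (intro mult_left_mono norm_b_le t) auto
    also have "\<dots> = M\<^sup>2 * (\<bar>of_int k\<bar> * norm (U t k))" by (simp add: Ux_eq[OF t] norm_mult)
    finally show "Re (Ux t k * cnj (b t k)) \<le> M\<^sup>2 * (\<bar>of_int k\<bar> * norm (U t k))" .
  qed auto
  also have "\<dots> = 2 * pi * M\<^sup>2 * (\<Sum>k\<in>?A. \<bar>of_int k\<bar> * norm (U t k))"
    by (simp only: sum_distrib_left[symmetric] mult.assoc)
  also have "\<dots> \<le> 2 * pi * M\<^sup>2 * (sqrt 2 * real N powr (3/2 - s) * Hs_norm s (\<lambda>x. of_real (u x t)))"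
    unfolding U_def using s N by (intro mult_left_mono sobolev_octave_le) auto
  finally show ?thesis .
qed

text \<open>In the constant, \<open>2 * pi\<close> comes from the initial projection error, the rest
  from the consistency error accumulated over a time of at most \<open>T\<close>.\<close>

lemma err_rate:
  assumes s: "3/2 < s" and N: "N \<ge> 1" and t1: "t1 \<in> {0..T}"
    and Hs0: "in_Hs s (\<lambda>x. of_real (u x 0))"
    and Hs: "\<And>t. t \<in> {0..t1} \<Longrightarrow> in_Hs s (\<lambda>x. of_real (u x t)) \<and> Hs_norm s (\<lambda>x. of_real (u x t)) \<le> Mu"
  shows "err t1 \<le> (2 * pi + 2 * pi * M\<^sup>2 * sqrt 2 * T) * exp (integral {0..t1} (\<lambda>t. Linf_norm (\<lambda>x. ux x t)))
    * (real N powr (- 2 * s) * (Hs_norm s (\<lambda>x. of_real (u x 0)))\<^sup>2 + real N powr (3/2 - s) * Mu)"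
proof -
  let ?h = "real N powr (- 2 * s) * (Hs_norm s (\<lambda>x. of_real (u x 0)))\<^sup>2"
  let ?r = "real N powr (3/2 - s) * Mu" and ?c = "2 * pi * M\<^sup>2 * sqrt 2"
  have 0: "0 \<in> {0..T}" using T_pos by simp
  have Mu: "0 \<le> Mu" using Hs[of 0] t1 Hs_norm_nonneg[of s "\<lambda>x. of_real (u x 0)"] by simp
  have sub: "t \<in> {0..T}" if "t \<in> {0..t1}" for t using that t1 by auto
  have "err t1 \<le> exp (integral {0..t1} (\<lambda>t. Linf_norm (\<lambda>x. ux x t)))
      * (F (\<lambda>_. 1) 0 + (2 * M * 0 + ?c * ?r + 2 * 0) * t1) + 2 * 0"
  proof (rule stability[OF continuous_on_Linf ux_le_Linf Linf_le_M])
    fix t assume t': "t \<in> {0..t1}"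
    note t = sub[OF t']
    show "\<bar>integral {0..2*pi} (\<lambda>x. Re (w x t) * (u x t - Tm (\<lambda>_. 1) (U t) x))\<bar> \<le> 0"
      unfolding U_def using integral_w_proj_zero[OF t continuous_on_u[OF t]] by simp
    have "continuous_on {0..2*pi} (\<lambda>x. u x t * ux x t)"
      by (intro continuous_intros continuous_on_u continuous_on_ux t)
    from integral_w_proj_zero[OF t this]
    show "- integral {0..2*pi} (\<lambda>x. Re (w x t) * (u x t * ux x t - Tm (\<lambda>_. 1) (P t) x)) \<le> 0"
      unfolding P_def by simp
    have "integral {0..2*pi} (\<lambda>x. (Re (w x t))\<^sup>2 * (ux x t - Tm (\<lambda>_. 1) (Ux t) x))
        \<le> 2 * pi * M\<^sup>2 * (sqrt 2 * real N powr (3/2 - s) * Hs_norm s (\<lambda>x. of_real (u x t)))"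
      using s N Hs[OF t'] by (intro consistency_le t) auto
    also have "\<dots> \<le> 2 * pi * M\<^sup>2 * (sqrt 2 * real N powr (3/2 - s) * Mu)"
      using Hs[OF t'] by (intro mult_left_mono) auto
    finally show "integral {0..2*pi} (\<lambda>x. (Re (w x t))\<^sup>2 * (ux x t - Tm (\<lambda>_. 1) (Ux t) x)) \<le> ?c * ?r"
      by (simp only: mult.assoc)
  qed (use t1 Mu in \<open>auto\<close>)
  also have "\<dots> \<le> exp (integral {0..t1} (\<lambda>t. Linf_norm (\<lambda>x. ux x t))) * ((2 * pi + ?c * T) * (?h + ?r))"
  proof -
    have "F (\<lambda>_. 1) 0 \<le> 2 * pi * ?h"
      unfolding F_init U_def using s N Hs0 u_le[OF 0]
      by (intro fourier_tail_le[of _ M] uniformly_continuous_on_u 0) (auto simp: periodic)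
    moreover have "?c * ?r * t1 \<le> ?c * ?r * T" using t1 Mu by (intro mult_left_mono) auto
    \<comment> \<open>Adding these cross terms lets one constant multiply both
      contributions.\<close>
    moreover have "0 \<le> 2 * pi * ?r" "0 \<le> ?c * T * ?h" using Mu T_pos by auto
    ultimately have "F (\<lambda>_. 1) 0 + ?c * ?r * t1 \<le> (2 * pi + ?c * T) * (?h + ?r)"
      by (simp add: algebra_simps)
    then show ?thesis by simp
  qed
  finally show ?thesis by (simp only: mult_ac)
qed

text \<open>The bound does not involve \<open>N\<close> and tends to 0 with \<open>e\<close>; the
  symbol enters only through uniform approximation in space and time.\<close>

lemma err_le_of_approx:
  assumes m: "0 \<le> e" and t1: "t1 \<in> {0..T}"
    and au: "\<And>x t. t \<in> {0..T} \<Longrightarrow> norm (trig N (\<lambda>k. of_real (m k) * U t k) x - of_real (u x t)) \<le> e"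
    and aux: "\<And>x t. t \<in> {0..T} \<Longrightarrow> norm (trig N (\<lambda>k. of_real (m k) * Ux t k) x - of_real (ux x t)) \<le> e"
    and ap: "\<And>x t. t \<in> {0..T} \<Longrightarrow> norm (trig N (\<lambda>k. of_real (m k) * P t k) x - of_real (u x t * ux x t)) \<le> e"
  shows "err t1 \<le> exp (M * t1) * (2 * pi * e\<^sup>2 + 2 * (2 * pi * (1 + M\<^sup>2) * e)
      + (2 * M * (2 * pi * (1 + M\<^sup>2) * e) + 2 * pi * M\<^sup>2 * e + 2 * (2 * pi * (1 + M\<^sup>2) * e)) * t1)
      + 2 * (2 * pi * (1 + M\<^sup>2) * e)"
proof -
  let ?k = "2 * pi * (1 + M\<^sup>2) * e"
  have 0: "0 \<in> {0..T}" using T_pos by simp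
  have sub: "t \<in> {0..T}" if "t \<in> {0..t1}" for t using that t1 by auto
  have Tm: "\<bar>g - Tm m c x\<bar> \<le> e" if "norm (trig N (\<lambda>k. of_real (m k) * c k) x - of_real g) \<le> e" for g c x
    using abs_Re_le_cmod[of "trig N (\<lambda>k. of_real (m k) * c k) x - of_real g"] that by (simp add: Tm_def)
  have lin: "\<bar>integral {0..2*pi} (\<lambda>x. Re (w x t) * (g x - Tm m c x))\<bar> \<le> ?k"
    if t: "t \<in> {0..T}" and g: "continuous_on {0..2*pi} g" "\<And>x. \<bar>g x - Tm m c x\<bar> \<le> e" for t g c
  proof -
    have "norm (integral {0..2*pi} (\<lambda>x. Re (w x t) * (g x - Tm m c x)))
        \<le> integral {0..2*pi} (\<lambda>x. e + e * (Re (w x t))\<^sup>2)"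
    proof (rule integral_norm_bound_integral)
      fix x
      \<comment> \<open>Controls the integral of the absolute value of \<open>w\<close> by the
        energy, which is the origin of the factor \<open>1 + M^2\<close>.\<close>
      have "\<bar>Re (w x t)\<bar> \<le> 1 + (Re (w x t))\<^sup>2"
        using sum_squares_bound[of "\<bar>Re (w x t)\<bar>" 1] abs_ge_zero[of "Re (w x t)"] by simp
      then have "\<bar>Re (w x t)\<bar> * \<bar>g x - Tm m c x\<bar> \<le> (1 + (Re (w x t))\<^sup>2) * e"
        using g(2)[of x] by (intro mult_mono) auto
      then show "norm (Re (w x t) * (g x - Tm m c x)) \<le> e + e * (Re (w x t))\<^sup>2"
        unfolding real_norm_def abs_mult by (simp add: distrib_right mult.commute[of e])
    qed (intro integrable_continuous_real continuous_intros continuous_on_w t g)+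
    also have "\<dots> = 2 * pi * e + e * integral {0..2*pi} (\<lambda>x. (Re (w x t))\<^sup>2)"
      by (subst integral_add) (auto intro!: integrable_continuous_real continuous_intros continuous_on_w t)
    also have "\<dots> \<le> 2 * pi * e + e * (2 * pi * M\<^sup>2)"
      using energy_w[OF t] m by (intro add_left_mono mult_left_mono) auto
    finally show ?thesis by (simp add: algebra_simps)
  qed
  have bu: "\<bar>integral {0..2*pi} (\<lambda>x. Re (w x t) * (u x t - Tm m (U t) x))\<bar> \<le> ?k" if "t \<in> {0..T}" for t
    using that by (intro lin continuous_on_u Tm au)
  have F0: "F m 0 \<le> 2 * pi * e\<^sup>2 + 2 * ?k"
  proof -
    \<comment> \<open>Initially the error is the projection error, and best approximation compares
      it with that of the multiplier.\<close>
    have "err 0 = F (\<lambda>_. 1) 0"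
      unfolding F_eq[OF 0] U_def using integral_w_proj_zero[OF 0 continuous_on_u[OF 0]] by simp
    also have "\<dots> \<le> integral {0..2*pi} (\<lambda>x. (norm (trig N (\<lambda>k. of_real (m k) * U 0 k) x - of_real (u x 0)))\<^sup>2)"
      unfolding F_init unfolding U_def by (rule fourier_best_approx[OF continuous_on_u[OF 0]])
    also have "\<dots> \<le> integral {0..2*pi} (\<lambda>x. e\<^sup>2)"
      using 0 by (intro integral_le integrable_continuous_real continuous_intros continuous_on_u power_mono au) auto
    finally have "err 0 \<le> 2 * pi * e\<^sup>2" by simp
    then show ?thesis unfolding F_eq[OF 0] using bu[OF 0] by linarith
  qed
  have k: "0 \<le> ?k" using m by simp
  have "err t1 \<le> exp (integral {0..t1} (\<lambda>_. M)) * (F m 0 + (2 * M * ?k + 2 * pi * M\<^sup>2 * e + 2 * ?k) * t1) + 2 * ?k"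
  proof (rule stability[OF _ ux_le])
    fix t assume "t \<in> {0..t1}"
    then have t: "t \<in> {0..T}" by (rule sub)
    show "\<bar>integral {0..2*pi} (\<lambda>x. Re (w x t) * (u x t - Tm m (U t) x))\<bar> \<le> ?k" by (rule bu[OF t])
    have "\<bar>integral {0..2*pi} (\<lambda>x. Re (w x t) * (u x t * ux x t - Tm m (P t) x))\<bar> \<le> ?k"
      by (intro lin continuous_on_u continuous_on_ux continuous_intros Tm ap t)
    then show "- integral {0..2*pi} (\<lambda>x. Re (w x t) * (u x t * ux x t - Tm m (P t) x)) \<le> ?k" by linarith
    have "integral {0..2*pi} (\<lambda>x. (Re (w x t))\<^sup>2 * (ux x t - Tm m (Ux t) x))
        \<le> integral {0..2*pi} (\<lambda>x. e * (Re (w x t))\<^sup>2)"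
    proof (intro integral_le integrable_continuous_real continuous_intros continuous_on_w continuous_on_ux t)
      fix x
      have "(Re (w x t))\<^sup>2 * (ux x t - Tm m (Ux t) x) \<le> (Re (w x t))\<^sup>2 * e"
        using Tm[OF aux[OF t, of x]] by (intro mult_left_mono) auto
      then show "(Re (w x t))\<^sup>2 * (ux x t - Tm m (Ux t) x) \<le> e * (Re (w x t))\<^sup>2" by (simp add: mult.commute)
    qed
    also have "\<dots> \<le> e * (2 * pi * M\<^sup>2)"
      using energy_w[OF t] m by (simp add: mult_left_mono)
    finally show "integral {0..2*pi} (\<lambda>x. (Re (w x t))\<^sup>2 * (ux x t - Tm m (Ux t) x)) \<le> 2 * pi * M\<^sup>2 * e"
      by (simp add: mult_ac)
  qed (use k m t1 in auto)
  also have "integral {0..t1} (\<lambda>_. M) = M * t1" using t1 by simp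
  also have "exp (M * t1) * (F m 0 + (2 * M * ?k + 2 * pi * M\<^sup>2 * e + 2 * ?k) * t1)
      \<le> exp (M * t1) * (2 * pi * e\<^sup>2 + 2 * ?k + (2 * M * ?k + 2 * pi * M\<^sup>2 * e + 2 * ?k) * t1)"
    using F0 by (intro mult_left_mono add_right_mono) auto
  finally show ?thesis by simp
qed

end

section \<open>Equicontinuity uniform in time, and assembly of both claims\<close>

text \<open>One \<open>d\<close> serves all times and all three functions, as a time-independent
  degree of the kernel requires.\<close>

lemma (in smooth_burgers) holder_equicontinuous:
  assumes \<alpha>: "0 < \<alpha>" "\<alpha> < 1" and e: "0 < e"
    and holder: "\<And>t x y. t \<in> {0..T} \<Longrightarrow> \<bar>ux x t - ux y t\<bar> \<le> M * \<bar>x - y\<bar> powr \<alpha>"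
  obtains d where "0 < d" "\<And>t x y. t \<in> {0..T} \<Longrightarrow> \<bar>x - y\<bar> < d \<Longrightarrow>
    \<bar>u x t - u y t\<bar> \<le> e \<and> \<bar>ux x t - ux y t\<bar> \<le> e \<and> \<bar>u x t * ux x t - u y t * ux y t\<bar> \<le> e"
proof -
  \<comment> \<open>Dominates the constant \<open>M\<close> for \<open>u\<close> and
    \<open>ux\<close> and \<open>2 * M^2\<close> for their product; the summand 1 keeps it
    positive.\<close>
  define K where "K = M + 2 * M\<^sup>2 + 1"
  have K: "0 < K" "M \<le> K" "2 * M\<^sup>2 \<le> K" using M_nonneg by (auto simp: K_def add_nonneg_pos)
  \<comment> \<open>The cap at 1 gives
    \<open>\<bar>x - y\<bar> \<le> \<bar>x - y\<bar> powr \<alpha>\<close>; the other entry gives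
    \<open>K * q \<le> e\<close>.\<close>
  define d where "d = min 1 ((e / K) powr (1 / \<alpha>))"
  have d: "0 < d" using e K by (simp add: d_def)
  show thesis
  proof (rule that[OF d])
    fix t x y assume t: "t \<in> {0..T}" and xy: "\<bar>x - y\<bar> < d"
    define q where "q = \<bar>x - y\<bar> powr \<alpha>"
    have q0: "0 \<le> q" by (simp add: q_def)
    have "q \<le> ((e / K) powr (1 / \<alpha>)) powr \<alpha>"
      unfolding q_def using xy \<alpha> by (intro powr_mono2) (auto simp: d_def)
    also have "\<dots> = e / K" using \<alpha> e K by (simp add: powr_powr)
    finally have q: "K * q \<le> e" using K by (simp add: field_simps)
    have le: "c * q \<le> e" if "c \<le> K" for c using mult_right_mono[OF that q0] q by linarith
    have "\<bar>x - y\<bar> powr 1 \<le> q"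
      unfolding q_def using xy \<alpha> by (intro powr_mono') (auto simp: d_def)
    then have "\<bar>x - y\<bar> \<le> q" by simp
    moreover have "\<bar>u x t - u y t\<bar> \<le> M * \<bar>x - y\<bar>"
      using field_differentiable_bound[of UNIV "\<lambda>x. u x t" "\<lambda>x. ux x t" M x y] ux_deriv[OF t] ux_le[OF t] by simp
    ultimately have 1: "\<bar>u x t - u y t\<bar> \<le> M * q"
      using mult_left_mono[of "\<bar>x - y\<bar>" q M] M_nonneg by linarith
    have 2: "\<bar>ux x t - ux y t\<bar> \<le> M * q" unfolding q_def by (rule holder[OF t])
    have "u x t * ux x t - u y t * ux y t = u x t * (ux x t - ux y t) + ux y t * (u x t - u y t)"
      by (simp add: algebra_simps)
    also have "\<bar>\<dots>\<bar> \<le> \<bar>u x t\<bar> * \<bar>ux x t - ux y t\<bar> + \<bar>ux y t\<bar> * \<bar>u x t - u y t\<bar>"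
      by (rule order_trans[OF abs_triangle_ineq]) (simp add: abs_mult)
    also have "\<dots> \<le> M * (M * q) + M * (M * q)"
      using M_nonneg by (intro add_mono mult_mono u_le ux_le t 1 2) auto
    also have "\<dots> = 2 * M\<^sup>2 * q" by (simp add: power2_eq_square)
    finally show "\<bar>u x t - u y t\<bar> \<le> e \<and> \<bar>ux x t - ux y t\<bar> \<le> e \<and> \<bar>u x t * ux x t - u y t * ux y t\<bar> \<le> e"
      using 1 2 le[OF K(2)] le[OF K(3)] by linarith
  qed
qed

text \<open>\<open>Mu\<close> ranges over all upper bounds of the Sobolev norms up to
  \<open>t\<close>, which covers their maximum. \<open>C\<close> is chosen before \<open>N\<close>,
  \<open>t\<close> and \<open>Mu\<close>.\<close>

theorem theorem3p1:
  fixes u ux :: "real \<Rightarrow> real \<Rightarrow> real"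
    and uN :: "nat \<Rightarrow> real \<Rightarrow> real \<Rightarrow> complex"
    and Tc \<alpha> :: real
  assumes Tc_pos: "Tc > 0"
    and alpha: "0 < \<alpha>" "\<alpha> < 1"
    and periodic: "\<And>x t. u (x + 2*pi) t = u x t"
    and u_cont: "continuous_on (UNIV \<times> {0..Tc}) (\<lambda>(x, t). u x t)"
    and ux_cont: "continuous_on (UNIV \<times> {0..Tc}) (\<lambda>(x, t). ux x t)"
    and ux_deriv: "\<And>x t. t \<in> {0..Tc} \<Longrightarrow> ((\<lambda>y. u y t) has_real_derivative ux x t) (at x)"
    and holder: "\<exists>M. \<forall>t\<in>{0..Tc}. \<forall>x y. \<bar>u x t\<bar> \<le> M \<and> \<bar>ux x t\<bar> \<le> M \<and>
                    \<bar>ux x t - ux y t\<bar> \<le> M * \<bar>x - y\<bar> powr \<alpha>"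
    and burgers: "\<And>x t. t \<in> {0..Tc} \<Longrightarrow>
        ((\<lambda>\<tau>. u x \<tau>) has_real_derivative (- (u x t * ux x t))) (at t within {0..Tc})"
    and uN_poly: "\<And>N t. t \<in> {0..Tc} \<Longrightarrow> (\<lambda>x. uN N x t) = PN N (\<lambda>x. uN N x t)"
    and uN_eq: "\<And>N x t. t \<in> {0..Tc} \<Longrightarrow>
        ((\<lambda>\<tau>. uN N x \<tau>) has_vector_derivative
           (- (1/2) * vector_derivative (\<lambda>y. PN N (\<lambda>z. (uN N z t)\<^sup>2) y) (at x)))
        (at t within {0..Tc})"
    and uN_init: "\<And>N. (\<lambda>x. uN N x 0) = PN N (\<lambda>x. complex_of_real (u x 0))"
  shows "(\<forall>t\<in>{0..Tc}. (\<lambda>N. L2norm (\<lambda>x. uN N x t - complex_of_real (u x t))) \<longlonglongrightarrow> 0)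
       \<and> (\<forall>s>3/2. \<exists>C. \<forall>N t Mu. N \<ge> 1 \<and> t \<in> {0..Tc}
             \<and> in_Hs s (\<lambda>x. complex_of_real (u x 0))
             \<and> (\<forall>\<tau>\<in>{0..t}. in_Hs s (\<lambda>x. complex_of_real (u x \<tau>))
                    \<and> Hs_norm s (\<lambda>x. complex_of_real (u x \<tau>)) \<le> Mu)
             \<longrightarrow> (L2norm (\<lambda>x. uN N x t - complex_of_real (u x t)))\<^sup>2
                 \<le> C * exp (integral {0..t} (\<lambda>\<tau>. Linf_norm (\<lambda>x. ux x \<tau>)))
                     * (real N powr (- 2 * s) * (Hs_norm s (\<lambda>x. complex_of_real (u x 0)))\<^sup>2
                        + real N powr (3/2 - s) * Mu))"
proof -
  obtain M where M: "\<And>t x. t \<in> {0..Tc} \<Longrightarrow> \<bar>u x t\<bar> \<le> M" "\<And>t x. t \<in> {0..Tc} \<Longrightarrow> \<bar>ux x t\<bar> \<le> M"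
    "\<And>t x y. t \<in> {0..Tc} \<Longrightarrow> \<bar>ux x t - ux y t\<bar> \<le> M * \<bar>x - y\<bar> powr \<alpha>"
    using holder by blast
  interpret smooth_burgers u ux Tc M
    by unfold_locales (fact Tc_pos periodic u_cont ux_cont ux_deriv M burgers)+
  have bg: "burgers_galerkin u ux Tc M N (uN N)" for N
  proof unfold_locales
    fix x
    \<comment> \<open>Coefficients of a real function are conjugate symmetric, and the range of
      modes is symmetric too.\<close>
    have "cnj (uN N x 0) = uN N x 0"
      unfolding fun_cong[OF uN_init[of N]] PN_eq_trig cnj_trig fcoef_cnj[symmetric] by simp
    then show "Im (uN N x 0) = 0" by (simp add: complex_eq_iff)
  qed (fact uN_poly uN_eq uN_init)+
  \<comment> \<open>\<open>err\<close> belongs to a locale interpreted anew for each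
    \<open>N\<close>; \<open>D\<close> names it across these scopes.\<close>
  define D where "D = (\<lambda>N. burgers_galerkin.err u (uN N))"
  have L2: "(L2norm (\<lambda>x. uN N x t - complex_of_real (u x t)))\<^sup>2 = D N t"
    and L2': "L2norm (\<lambda>x. uN N x t - complex_of_real (u x t)) = sqrt (D N t)"
    if t: "t \<in> {0..Tc}" for N t
  proof -
    interpret burgers_galerkin u ux Tc M N "uN N" by (rule bg)
    show *: "L2norm (\<lambda>x. uN N x t - complex_of_real (u x t)) = sqrt (D N t)"
      by (simp add: L2norm_def D_def err_eq_norm[OF t])
    have "0 \<le> D N t"
      unfolding D_def err_eq_norm[OF t]
      by (intro integral_nonneg integrable_continuous_real continuous_intros continuous_on_w continuous_on_u t) auto
    then show "(L2norm (\<lambda>x. uN N x t - complex_of_real (u x t)))\<^sup>2 = D N t"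
      unfolding * by simp
  qed
  have "(\<lambda>N. L2norm (\<lambda>x. uN N x t - complex_of_real (u x t))) \<longlonglongrightarrow> 0" if t: "t \<in> {0..Tc}" for t
    unfolding L2'[OF t]
  proof (rule tendsto_real_sqrt[of _ 0, simplified], rule LIMSEQ_I)
    fix r :: real assume r: "0 < r"
    \<comment> \<open>The bound of \<open>err_le_of_approx\<close> as a function of
      \<open>e\<close>, continuous with value 0 at 0. The order of choice is \<open>e\<close> from
      \<open>r\<close>, \<open>d\<close> from \<open>e\<close>, then \<open>n\<close>, all before
      \<open>N\<close>.\<close>
    let ?G = "\<lambda>e. exp (M * t) * (2 * pi * e\<^sup>2 + 2 * (2 * pi * (1 + M\<^sup>2) * e)
      + (2 * M * (2 * pi * (1 + M\<^sup>2) * e) + 2 * pi * M\<^sup>2 * e + 2 * (2 * pi * (1 + M\<^sup>2) * e)) * t)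
      + 2 * (2 * pi * (1 + M\<^sup>2) * e)"
    have "isCont ?G 0" by (intro continuous_intros)
    then have "(?G \<longlongrightarrow> 0) (at 0)" unfolding isCont_def by simp
    then have "(?G \<longlongrightarrow> 0) (at_right 0)" by (rule filterlim_mono) (auto simp: at_le)
    then have "eventually (\<lambda>e. ?G e < r) (at_right 0)" using r by (rule order_tendstoD)
    then obtain e where e: "0 < e" "?G e < r"
      using eventually_happens'[OF trivial_limit_at_right_real, OF eventually_conj[OF _ eventually_at_right_less]]
      by blast
    \<comment> \<open>\<open>e / 2\<close> compensates for the factor 2 in
      \<open>uniform_trig_approx\<close>.\<close>
    obtain d where d: "0 < d" "\<And>t x y. t \<in> {0..Tc} \<Longrightarrow> \<bar>x - y\<bar> < d \<Longrightarrow>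
        \<bar>u x t - u y t\<bar> \<le> e / 2 \<and> \<bar>ux x t - ux y t\<bar> \<le> e / 2 \<and> \<bar>u x t * ux x t - u y t * ux y t\<bar> \<le> e / 2"
      using holder_equicontinuous[OF alpha _ M(3), of "e / 2"] e by auto
    \<comment> \<open>\<open>M + M * M\<close> bounds \<open>u\<close>, \<open>ux\<close> and
      \<open>u * ux\<close> alike, so that a single \<open>n\<close> results.\<close>
    obtain n where n: "\<And>N f x. n \<le> N \<Longrightarrow> continuous_on UNIV f \<Longrightarrow> (\<And>x. f (x + 2*pi) = f x) \<Longrightarrow>
        (\<And>x. norm (f x) \<le> M + M * M) \<Longrightarrow> (\<And>x y. \<bar>x - y\<bar> < d \<Longrightarrow> norm (f x - f y) \<le> e / 2) \<Longrightarrow>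
        norm (trig N (\<lambda>k. of_real (cos_mult n k) * fcoef f k) x - f x) \<le> 2 * (e / 2)"
      using uniform_trig_approx[OF d(1) half_gt_zero[OF e(1)], of "M + M * M"] by blast
    show "\<exists>no. \<forall>N\<ge>no. norm (D N t - 0) < r"
    proof (intro exI allI impI)
      fix N assume N: "n \<le> N"
      interpret burgers_galerkin u ux Tc M N "uN N" by (rule bg)
      have approx: "norm (trig N (\<lambda>k. of_real (cos_mult n k) * fcoef (\<lambda>x. of_real (g x)) k) x - of_real (g x)) \<le> e"
        if "continuous_on UNIV g" "\<And>x. g (x + 2*pi) = g x" "\<And>x. \<bar>g x\<bar> \<le> M + M * M"
          "\<And>x y. \<bar>x - y\<bar> < d \<Longrightarrow> \<bar>g x - g y\<bar> \<le> e / 2" for g x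
      proof -
        have "norm (trig N (\<lambda>k. of_real (cos_mult n k) * fcoef (\<lambda>x. of_real (g x)) k) x - of_real (g x)) \<le> 2 * (e / 2)"
          using that by (intro n N) (auto simp: continuous_on_of_real simp flip: of_real_diff)
        then show ?thesis by simp
      qed
      have le: "M \<le> M + M * M" using M_nonneg by simp
      have "D N t \<le> ?G e"
        unfolding D_def
      proof (rule err_le_of_approx[where m="cos_mult n"])
        fix x s assume s: "s \<in> {0..Tc}"
        show "norm (trig N (\<lambda>k. of_real (cos_mult n k) * U s k) x - of_real (u x s)) \<le> e"
          unfolding U_def using d(2)[OF s] order_trans[OF u_le[OF s] le]
          by (intro approx continuous_on_u s periodic) blast+
        show "norm (trig N (\<lambda>k. of_real (cos_mult n k) * Ux s k) x - of_real (ux x s)) \<le> e"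
          unfolding Ux_def using d(2)[OF s] order_trans[OF ux_le[OF s] le]
          by (intro approx continuous_on_ux s ux_periodic) blast+
        have "\<bar>u x s * ux x s\<bar> \<le> M + M * M" for x
          using mult_mono[OF u_le[OF s, of x] ux_le[OF s, of x]] M_nonneg by (simp add: abs_mult)
        then show "norm (trig N (\<lambda>k. of_real (cos_mult n k) * P s k) x - of_real (u x s * ux x s)) \<le> e"
          unfolding P_def using d(2)[OF s]
          by (intro approx continuous_intros continuous_on_u continuous_on_ux s)
            (simp_all add: periodic ux_periodic[OF s])
      qed (use e t in auto)
      moreover have "0 \<le> D N t" using L2[OF t, of N] zero_le_power2 by metis
      ultimately show "norm (D N t - 0) < r" using e(2) by simp
    qed
  qed
  moreover have "\<exists>C. \<forall>N t Mu. N \<ge> 1 \<and> t \<in> {0..Tc}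
             \<and> in_Hs s (\<lambda>x. complex_of_real (u x 0))
             \<and> (\<forall>\<tau>\<in>{0..t}. in_Hs s (\<lambda>x. complex_of_real (u x \<tau>))
                    \<and> Hs_norm s (\<lambda>x. complex_of_real (u x \<tau>)) \<le> Mu)
             \<longrightarrow> (L2norm (\<lambda>x. uN N x t - complex_of_real (u x t)))\<^sup>2
                 \<le> C * exp (integral {0..t} (\<lambda>\<tau>. Linf_norm (\<lambda>x. ux x \<tau>)))
                     * (real N powr (- 2 * s) * (Hs_norm s (\<lambda>x. complex_of_real (u x 0)))\<^sup>2
                        + real N powr (3/2 - s) * Mu)" if s: "s > 3/2" for s
  \<comment> \<open>The constant of \<open>err_rate\<close>, which depends on the solution through
    \<open>M\<close> and on \<open>Tc\<close>.\<close>
  proof (intro exI[of _ "2 * pi + 2 * pi * M\<^sup>2 * sqrt 2 * Tc"] allI impI, elim conjE)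
    fix N :: nat and t Mu
    assume *: "1 \<le> N" "t \<in> {0..Tc}" "in_Hs s (\<lambda>x. complex_of_real (u x 0))"
      "\<forall>\<tau>\<in>{0..t}. in_Hs s (\<lambda>x. complex_of_real (u x \<tau>)) \<and> Hs_norm s (\<lambda>x. complex_of_real (u x \<tau>)) \<le> Mu"
    interpret burgers_galerkin u ux Tc M N "uN N" by (rule bg)
    show "(L2norm (\<lambda>x. uN N x t - complex_of_real (u x t)))\<^sup>2
        \<le> (2 * pi + 2 * pi * M\<^sup>2 * sqrt 2 * Tc) * exp (integral {0..t} (\<lambda>\<tau>. Linf_norm (\<lambda>x. ux x \<tau>)))
          * (real N powr (- 2 * s) * (Hs_norm s (\<lambda>x. complex_of_real (u x 0)))\<^sup>2
             + real N powr (3/2 - s) * Mu)"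
      unfolding L2[OF *(2)] D_def using *(4) by (intro err_rate s * bspec[OF *(4)])
  qed
  ultimately show ?thesis by blast
qed

end
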